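(* Let $\Phi : \mathbb{M}_n\to \mathbb{M}_d$ be a unital positive linear map, let $f(t)$ be a convex function on an interval $\Omega\subset\mathbb{R}$, and let $A\in \mathbb{M}_n\{\Omega\}$. Then there exist unitaries $U,V\in\mathbb{M}_d$ such that $$f(\Phi(A))\le \frac{U\Phi( f(A))U^*+V\Phi( f(A))V^*}{2}.$$ If furthermore $f(t)$ is monotone, then one can take $U=V$. For concave functions $f$ on $\Omega$ the same statements hold with the inequality reversed.
   Context: $\mathbb{M}_n$ is the algebra of complex $n\times n$ matrices (operators on an $n$-dimensional Hilbert space), and $\mathbb{M}_n^+$ is its positive semi-definite part. For an interval $\Omega$ of the real line, $\mathbb{M}_n\{\Omega\}$ denotes the set of Hermitian matrices in $\mathbb{M}_n$ whose spectrum lies in $\Omega$. $X\le Y$ means that $X,Y$ are Hermitian and $Y-X$ is positive semi-definite. $f(A)$ is defined by the usual functional calculus. A linear map $\Phi:\mathbb{M}_n\to\mathbb{M}_d$ is unital if $\Phi(I)=I$ and positive if $\Phi(A)\in\mathbb{M}_d^+$ for all $A\in\mathbb{M}_n^+$. *)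

theory Defs
  imports
    "HOL-Analysis.Analysis"
    "Jordan_Normal_Form.Spectral_Radius"
    "Jordan_Normal_Form.Schur_Decomposition"
begin

definition hermitian_mats :: "nat \<Rightarrow> complex mat set" where
  "hermitian_mats n = {A \<in> carrier_mat n n. mat_adjoint A = A}"

definition unitary_mats :: "nat \<Rightarrow> complex mat set" where
  "unitary_mats n =
    {U \<in> carrier_mat n n. mat_adjoint U * U = 1\<^sub>m n \<and> U * mat_adjoint U = 1\<^sub>m n}"

text \<open>The form below is real on Hermitian matrices, so taking the real part loses nothing.\<close>

definition psd_mats :: "nat \<Rightarrow> complex mat set" where
  "psd_mats n =
    {A \<in> hermitian_mats n. \<forall>v \<in> carrier_vec n. 0 \<le> Re ((A *\<^sub>v v) \<bullet>c v)}"

text \<open>The Loewner order; the library's \<open>\<le>\<close> on matrices is the entrywise order.\<close>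

definition loewner_le :: "nat \<Rightarrow> complex mat \<Rightarrow> complex mat \<Rightarrow> bool" where
  "loewner_le n X Y \<longleftrightarrow>
    X \<in> hermitian_mats n \<and> Y \<in> hermitian_mats n \<and> Y - X \<in> psd_mats n"

definition hermitian_mats_in :: "nat \<Rightarrow> real set \<Rightarrow> complex mat set" where
  "hermitian_mats_in n \<Omega> = {A \<in> hermitian_mats n. spectrum A \<subseteq> of_real ` \<Omega>}"

text \<open>
  \<open>diagonalizes A U l\<close>: the columns of the unitary \<open>U\<close> are an orthonormal eigenbasis of \<open>A\<close>
  with real eigenvalues \<open>l 0, l 1, \<dots>\<close> (repeated according to multiplicity).
\<close>

definition diagonalizes :: "complex mat \<Rightarrow> complex mat \<Rightarrow> (nat \<Rightarrow> real) \<Rightarrow> bool" where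
  "diagonalizes A U l \<longleftrightarrow> U \<in> unitary_mats (dim_row A) \<and>
    A = U * mat_diag (dim_row A) (\<lambda>i. complex_of_real (l i)) * mat_adjoint U"

text \<open>
  Functional calculus for Hermitian matrices. The result does not depend on the chosen
  diagonalization, see \<open>mat_fun_eqI\<close>; only the values of \<open>f\<close> on the spectrum matter.
\<close>

definition mat_fun :: "(real \<Rightarrow> real) \<Rightarrow> complex mat \<Rightarrow> complex mat" where
  "mat_fun f A = (THE B. \<exists>U l. diagonalizes A U l \<and>
    B = U * mat_diag (dim_row A) (\<lambda>i. complex_of_real (f (l i))) * mat_adjoint U)"

definition linear_mat_map :: "nat \<Rightarrow> nat \<Rightarrow> (complex mat \<Rightarrow> complex mat) \<Rightarrow> bool" where
  "linear_mat_map n d \<Phi> \<longleftrightarrow>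
    \<Phi> \<in> carrier_mat n n \<rightarrow> carrier_mat d d \<and>
    (\<forall>X \<in> carrier_mat n n. \<forall>Y \<in> carrier_mat n n. \<Phi> (X + Y) = \<Phi> X + \<Phi> Y) \<and>
    (\<forall>c. \<forall>X \<in> carrier_mat n n. \<Phi> (c \<cdot>\<^sub>m X) = c \<cdot>\<^sub>m \<Phi> X)"

definition unital_positive_linear_map ::
    "nat \<Rightarrow> nat \<Rightarrow> (complex mat \<Rightarrow> complex mat) \<Rightarrow> bool" where
  "unital_positive_linear_map n d \<Phi> \<longleftrightarrow>
    linear_mat_map n d \<Phi> \<and> \<Phi> (1\<^sub>m n) = 1\<^sub>m d \<and> (\<forall>X \<in> psd_mats n. \<Phi> X \<in> psd_mats d)"

definition conj_by :: "complex mat \<Rightarrow> complex mat \<Rightarrow> complex mat" where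
  "conj_by U X = U * X * mat_adjoint U"

lemma mat_adjoint_carrier: "U \<in> carrier_mat n m \<Longrightarrow> mat_adjoint U \<in> carrier_mat m n"
  unfolding mat_adjoint_def by auto

lemma diagonal_intertwine:
  fixes X :: "complex mat"
  assumes X: "X \<in> carrier_mat n n"
    and eq: "X * mat_diag n (\<lambda>i. complex_of_real (l i)) = mat_diag n (\<lambda>i. complex_of_real (m i)) * X"
  shows "X * mat_diag n (\<lambda>i. complex_of_real (f (l i)))
       = mat_diag n (\<lambda>i. complex_of_real (f (m i))) * X"
proof (rule eq_matI)
  fix i j
  assume "i < dim_row (mat_diag n (\<lambda>i. complex_of_real (f (m i))) * X)"
    and "j < dim_col (mat_diag n (\<lambda>i. complex_of_real (f (m i))) * X)"
  then have ij: "i < n" "j < n" using X by (auto simp: mat_diag_def)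
  have "(X * mat_diag n (\<lambda>i. complex_of_real (l i))) $$ (i,j)
      = (mat_diag n (\<lambda>i. complex_of_real (m i)) * X) $$ (i,j)"
    using eq by simp
  then have "X $$ (i,j) * complex_of_real (l j) = complex_of_real (m i) * X $$ (i,j)"
    using ij by (simp add: mat_diag_mult_right[OF X] mat_diag_mult_left[OF X])
  then have "X $$ (i,j) = 0 \<or> l j = m i"
    by auto
  then show "(X * mat_diag n (\<lambda>i. complex_of_real (f (l i)))) $$ (i,j)
      = (mat_diag n (\<lambda>i. complex_of_real (f (m i))) * X) $$ (i,j)"
    using ij by (auto simp: mat_diag_mult_right[OF X] mat_diag_mult_left[OF X])
qed (use X in \<open>auto simp: mat_diag_def\<close>)

lemma diagonalizes_unique:
  assumes "diagonalizes A U l" and "diagonalizes A W m"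
  shows "U * mat_diag (dim_row A) (\<lambda>i. complex_of_real (f (l i))) * mat_adjoint U
       = W * mat_diag (dim_row A) (\<lambda>i. complex_of_real (f (m i))) * mat_adjoint W"
proof -
  define n where "n = dim_row A"
  define D where "D = mat_diag n (\<lambda>i. complex_of_real (l i))"
  define E where "E = mat_diag n (\<lambda>i. complex_of_real (m i))"
  define D' where "D' = mat_diag n (\<lambda>i. complex_of_real (f (l i)))"
  define E' where "E' = mat_diag n (\<lambda>i. complex_of_real (f (m i)))"
  define Us where "Us = mat_adjoint U"
  define Ws where "Ws = mat_adjoint W"
  have c: "U \<in> carrier_mat n n" "W \<in> carrier_mat n n" "Us \<in> carrier_mat n n"
      "Ws \<in> carrier_mat n n" "D \<in> carrier_mat n n" "E \<in> carrier_mat n n"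
      "D' \<in> carrier_mat n n" "E' \<in> carrier_mat n n"
    using assms mat_adjoint_carrier[of U n n] mat_adjoint_carrier[of W n n]
    unfolding diagonalizes_def unitary_mats_def n_def[symmetric] D_def E_def D'_def E'_def
      Us_def Ws_def by auto
  have u: "Us * U = 1\<^sub>m n" "U * Us = 1\<^sub>m n" "Ws * W = 1\<^sub>m n" "W * Ws = 1\<^sub>m n"
    and eq: "U * D * Us = W * E * Ws"
    using assms unfolding diagonalizes_def unitary_mats_def n_def[symmetric] D_def E_def
      Us_def Ws_def by auto
  define X where "X = Ws * U"
  have X: "X \<in> carrier_mat n n" using c by (simp add: X_def)
  have "Ws * (U * D * Us) * U = Ws * (W * E * Ws) * U" using eq by simp
  moreover have "Ws * (U * D * Us) * U = Ws * U * D * (Us * U)"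
    using c by (simp add: assoc_mult_mat[of _ n n _ n _ n])
  moreover have "Ws * (W * E * Ws) * U = Ws * W * E * (Ws * U)"
    using c by (simp add: assoc_mult_mat[of _ n n _ n _ n])
  ultimately have "X * D = E * X"
    using c u X by (simp add: X_def)
  then have XD: "X * D' = E' * X"
    using diagonal_intertwine[OF X] unfolding D_def E_def D'_def E'_def by blast
  have "U * D' * Us = W * Ws * U * D' * Us" using c u by simp
  also have "\<dots> = W * (X * D') * Us"
    using c by (simp add: X_def assoc_mult_mat[of _ n n _ n _ n])
  also have "\<dots> = W * (E' * X) * Us" by (simp only: XD)
  also have "\<dots> = W * E' * Ws * (U * Us)"
    using c by (simp add: X_def assoc_mult_mat[of _ n n _ n _ n])
  also have "\<dots> = W * E' * Ws" using c u by simp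
  finally show ?thesis unfolding D'_def E'_def n_def Us_def Ws_def .
qed

lemma mat_fun_eqI:
  assumes "diagonalizes A U l"
  shows "mat_fun f A = U * mat_diag (dim_row A) (\<lambda>i. complex_of_real (f (l i))) * mat_adjoint U"
  unfolding mat_fun_def
  by (rule the_equality) (use assms diagonalizes_unique in blast)+

end

(* Diagonalize B = \<Phi> A in an orthonormal eigenbasis with eigenvalues b i, and write X = \<Phi> (f A).
   The numbers Re (\<Phi> (P i) h . h), with P i the eigenprojections of A, are up to normalization
   probability weights, so scalar Jensen gives f (B h . h) <= X h . h for unit vectors h.
   On the part of the interval where f is monotone, f at an average of the b i is at least the
   smallest f (b i) that occurs, so X h . h dominates the smallest f (b i) over the support of h.
   By a min-max argument the sorted eigenvalues of X then dominate the sorted f (b i), which is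
   the inequality up to one unitary. A convex f is decreasing and then increasing, so for general f
   the eigenbasis splits into two parts of this kind, and the argument applies to the corresponding
   pinching of X, which is the mean of two unitary conjugates of X. *)
theory Submission
  imports Defs
begin

unbundle no vec_syntax

section \<open>Adjoints and the action of diagonal matrices\<close>

lemma mat_adjoint_index [simp]:
  "i < dim_col A \<Longrightarrow> j < dim_row A \<Longrightarrow> mat_adjoint A $$ (i, j) = conjugate (A $$ (j, i))"
  unfolding mat_adjoint_def by (simp add: mat_of_rows_index)

lemma dim_mat_adjoint [simp]:
  "dim_row (mat_adjoint A) = dim_col A" "dim_col (mat_adjoint A) = dim_row A"
  unfolding mat_adjoint_def by simp_all

lemma mat_adjoint_adjoint [simp]: "mat_adjoint (mat_adjoint A) = A"
  by (rule eq_matI) auto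

lemma mat_adjoint_mult:
  fixes A B :: "complex mat"
  assumes "A \<in> carrier_mat n m" "B \<in> carrier_mat m k"
  shows "mat_adjoint (A * B) = mat_adjoint B * mat_adjoint A"
  using assms by (intro eq_matI) (auto simp: scalar_prod_def mult.commute)

lemma mat_adjoint_add:
  fixes A B :: "complex mat"
  assumes "A \<in> carrier_mat n m" "B \<in> carrier_mat n m"
  shows "mat_adjoint (A + B) = mat_adjoint A + mat_adjoint B"
  using assms by (intro eq_matI) auto

lemma mat_adjoint_smult:
  "mat_adjoint (c \<cdot>\<^sub>m A) = conjugate c \<cdot>\<^sub>m mat_adjoint (A :: complex mat)"
  by (intro eq_matI) auto

lemma mat_adjoint_mat_diag:
  "mat_adjoint (mat_diag n (c :: nat \<Rightarrow> complex)) = mat_diag n (\<lambda>i. conjugate (c i))"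
  by (intro eq_matI) (auto simp: mat_diag_def)

lemma cscalar_prod_mat_adjoint:
  fixes A :: "complex mat"
  assumes "A \<in> carrier_mat m n" "v \<in> carrier_vec n" "w \<in> carrier_vec m"
  shows "(A *\<^sub>v v) \<bullet>c w = v \<bullet>c (mat_adjoint A *\<^sub>v w)"
proof -
  have "(A *\<^sub>v v) \<bullet>c w = (\<Sum>i<m. \<Sum>j<n. A $$ (i, j) * v $ j * cnj (w $ i))"
    using assms by (simp add: scalar_prod_def sum_distrib_right lessThan_atLeast0)
  also have "\<dots> = (\<Sum>j<n. \<Sum>i<m. A $$ (i, j) * v $ j * cnj (w $ i))"
    by (rule sum.swap)
  also have "\<dots> = v \<bullet>c (mat_adjoint A *\<^sub>v w)"
    using assms by (simp add: scalar_prod_def sum_distrib_left lessThan_atLeast0 mult_ac)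
  finally show ?thesis .
qed

lemma mat_diag_mult_vec_index:
  fixes v :: "complex vec"
  assumes v: "v \<in> carrier_vec n" and i: "i < n"
  shows "(mat_diag n c *\<^sub>v v) $ i = c i * v $ i"
proof -
  have "(mat_diag n c *\<^sub>v v) $ i = (\<Sum>j<n. mat_diag n c $$ (i, j) * v $ j)"
    using i v by (simp add: mat_diag_def scalar_prod_def lessThan_atLeast0)
  also have "\<dots> = (\<Sum>j<n. if j = i then c i * v $ i else 0)"
    using i by (intro sum.cong refl) (simp add: mat_diag_def)
  finally show ?thesis using i by simp
qed

section \<open>The real quadratic form of a matrix\<close>

definition rform :: "complex mat \<Rightarrow> complex vec \<Rightarrow> real" where
  "rform M v = Re ((M *\<^sub>v v) \<bullet>c v)"

text \<open>This expansion reduces linearity in the matrix and the parallelogram law to identities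
  between single summands.\<close>

lemma rform_sum:
  assumes "M \<in> carrier_mat n n" "v \<in> carrier_vec n"
  shows "rform M v = (\<Sum>i<n. \<Sum>j<n. Re (M $$ (i, j) * v $ j * cnj (v $ i)))"
  using assms unfolding rform_def
  by (simp add: scalar_prod_def sum_distrib_right lessThan_atLeast0 del: times_complex.simps)

lemma rform_add:
  assumes "M \<in> carrier_mat n n" "N \<in> carrier_mat n n" "v \<in> carrier_vec n"
  shows "rform (M + N) v = rform M v + rform N v"
proof -
  have c: "M + N \<in> carrier_mat n n" using assms by simp
  then show ?thesis
    using assms unfolding rform_sum[OF assms(1,3)] rform_sum[OF assms(2,3)] rform_sum[OF c assms(3)]
      sum.distrib[symmetric] plus_complex.simps(1)[symmetric]
    by (intro sum.cong refl arg_cong[where f = Re]) (auto simp: algebra_simps)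
qed

lemma rform_diff:
  assumes "M \<in> carrier_mat n n" "N \<in> carrier_mat n n" "v \<in> carrier_vec n"
  shows "rform (M - N) v = rform M v - rform N v"
proof -
  have c: "M - N \<in> carrier_mat n n" using assms by (simp add: minus_carrier_mat)
  then show ?thesis
    using assms unfolding rform_sum[OF assms(1,3)] rform_sum[OF assms(2,3)] rform_sum[OF c assms(3)]
      sum_subtractf[symmetric] minus_complex.simps(1)[symmetric]
    by (intro sum.cong refl arg_cong[where f = Re]) (auto simp: algebra_simps)
qed

lemma rform_smult:
  assumes "M \<in> carrier_mat n n" "v \<in> carrier_vec n"
  shows "rform (complex_of_real c \<cdot>\<^sub>m M) v = c * rform M v"
proof -
  have c: "complex_of_real c \<cdot>\<^sub>m M \<in> carrier_mat n n" using assms by simp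
  have r: "c * Re z = Re (complex_of_real c * z)" for z by simp
  then show ?thesis
    using assms unfolding rform_sum[OF assms] rform_sum[OF c assms(2)] sum_distrib_left
      r
    by (intro sum.cong refl arg_cong[where f = Re]) (auto simp: algebra_simps)
qed

lemma rform_conj_by:
  assumes "U \<in> carrier_mat n n" "M \<in> carrier_mat n n" "v \<in> carrier_vec n"
  shows "rform (conj_by U M) v = rform M (mat_adjoint U *\<^sub>v v)"
proof -
  have a: "mat_adjoint U \<in> carrier_mat n n" using assms mat_adjoint_carrier by blast
  have "conj_by U M *\<^sub>v v = U *\<^sub>v (M *\<^sub>v (mat_adjoint U *\<^sub>v v))"
    using assms a by (simp add: conj_by_def assoc_mult_mat_vec[of _ n n _ n])
  then show ?thesis
    using assms a by (simp add: rform_def cscalar_prod_mat_adjoint[of _ n n])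
qed

lemma rform_mat_diag:
  assumes "v \<in> carrier_vec n"
  shows "rform (mat_diag n (\<lambda>i. complex_of_real (c i))) v = (\<Sum>i<n. c i * (cmod (v $ i))\<^sup>2)"
proof -
  have "rform (mat_diag n (\<lambda>i. complex_of_real (c i))) v
      = (\<Sum>i<n. \<Sum>j<n. if j = i then c i * (cmod (v $ i))\<^sup>2 else 0)"
    unfolding rform_sum[OF mat_diag_dim assms]
  proof (intro sum.cong refl)
    fix i j assume ij: "i \<in> {..<n}" "j \<in> {..<n}"
    have "complex_of_real (c i) * v $ i * cnj (v $ i) = complex_of_real (c i * (cmod (v $ i))\<^sup>2)"
      unfolding mult.assoc complex_norm_square[symmetric] by simp
    then have "Re (complex_of_real (c i) * v $ i * cnj (v $ i)) = c i * (cmod (v $ i))\<^sup>2"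
      using Re_complex_of_real by metis
    then show "Re (mat_diag n (\<lambda>i. complex_of_real (c i)) $$ (i, j) * v $ j * cnj (v $ i))
        = (if j = i then c i * (cmod (v $ i))\<^sup>2 else 0)"
      using ij by (auto simp: mat_diag_def simp del: times_complex.simps)
  qed
  then show ?thesis by simp
qed

lemma rform_one:
  assumes "v \<in> carrier_vec n"
  shows "rform (1\<^sub>m n) v = (\<Sum>i<n. (cmod (v $ i))\<^sup>2)"
  using rform_mat_diag[OF assms, of "\<lambda>_. 1"] by simp

lemma rform_one_pos:
  assumes "v \<in> carrier_vec n" "v \<noteq> 0\<^sub>v n"
  shows "0 < rform (1\<^sub>m n) v"
proof -
  obtain i where i: "i < n" "v $ i \<noteq> 0"
    using assms by (metis eq_vecI carrier_vecD index_zero_vec)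
  have "0 < (cmod (v $ i))\<^sup>2" using i by simp
  also have "\<dots> \<le> (\<Sum>i<n. (cmod (v $ i))\<^sup>2)"
    by (rule member_le_sum) (use i in auto)
  finally show ?thesis using assms by (simp add: rform_one)
qed

text \<open>The cross terms of \<open>u\<close> and \<open>w\<close> cancel. With \<open>u\<close>
  and \<open>w\<close> the two block components of a vector, this evaluates the form of a pinching
  as the sum of the forms on the blocks.\<close>

lemma rform_parallelogram:
  assumes M: "M \<in> carrier_mat n n" and u: "u \<in> carrier_vec n" and w: "w \<in> carrier_vec n"
  shows "rform M (u + w) + rform M (u - w) = 2 * (rform M u + rform M w)"
proof -
  have c: "u + w \<in> carrier_vec n" "u - w \<in> carrier_vec n"
    using u w by (auto simp: minus_carrier_vec)
  then show ?thesis
    using M u w unfolding mult_2 rform_sum[OF M u] rform_sum[OF M w] rform_sum[OF M c(1)] rform_sum[OF M c(2)]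
      sum.distrib[symmetric] plus_complex.simps(1)[symmetric]
    by (intro sum.cong refl arg_cong[where f = Re]) (auto simp: algebra_simps)
qed

section \<open>Hermitian and unitary matrices, and conjugation\<close>

lemma unitary_carrier: "U \<in> unitary_mats n \<Longrightarrow> U \<in> carrier_mat n n"
  by (simp add: unitary_mats_def)

lemma hermitian_carrier: "A \<in> hermitian_mats n \<Longrightarrow> A \<in> carrier_mat n n"
  by (simp add: hermitian_mats_def)

lemma mat_diag_hermitian: "mat_diag n (\<lambda>i. complex_of_real (c i)) \<in> hermitian_mats n"
  by (simp add: hermitian_mats_def mat_adjoint_mat_diag)

lemma hermitian_add:
  "A \<in> hermitian_mats n \<Longrightarrow> B \<in> hermitian_mats n \<Longrightarrow> A + B \<in> hermitian_mats n"
  by (auto simp: hermitian_mats_def mat_adjoint_add[of _ n n])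

lemma hermitian_smult:
  "A \<in> hermitian_mats n \<Longrightarrow> complex_of_real c \<cdot>\<^sub>m A \<in> hermitian_mats n"
  by (auto simp: hermitian_mats_def mat_adjoint_smult)

lemma hermitian_diff:
  assumes "A \<in> hermitian_mats n" "B \<in> hermitian_mats n"
  shows "A - B \<in> hermitian_mats n"
proof -
  have "A - B = A + complex_of_real (-1) \<cdot>\<^sub>m B"
    using assms by (intro eq_matI) (auto simp: hermitian_mats_def)
  then show ?thesis using assms hermitian_add hermitian_smult by metis
qed

lemma conj_by_carrier [simp]:
  "U \<in> carrier_mat n n \<Longrightarrow> M \<in> carrier_mat n n \<Longrightarrow> conj_by U M \<in> carrier_mat n n"
  using mat_adjoint_carrier unfolding conj_by_def by (metis mult_carrier_mat)

lemma conj_by_conj_by: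
  assumes "U \<in> carrier_mat n n" "V \<in> carrier_mat n n" "M \<in> carrier_mat n n"
  shows "conj_by U (conj_by V M) = conj_by (U * V) M"
  using assms mat_adjoint_carrier[of U n n] mat_adjoint_carrier[of V n n]
  by (simp add: conj_by_def mat_adjoint_mult[of _ n n _ n] assoc_mult_mat[of _ n n _ n _ n])

lemma conj_by_add:
  assumes "U \<in> carrier_mat n n" "M \<in> carrier_mat n n" "N \<in> carrier_mat n n"
  shows "conj_by U (M + N) = conj_by U M + conj_by U N"
  using assms mat_adjoint_carrier[of U n n]
  by (simp add: conj_by_def mult_add_distrib_mat[of _ n n _ n] add_mult_distrib_mat[of _ n n _ _ n])

lemma conj_by_smult:
  assumes "U \<in> carrier_mat n n" "M \<in> carrier_mat n n"
  shows "conj_by U (c \<cdot>\<^sub>m M) = c \<cdot>\<^sub>m conj_by U M"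
  using assms mat_adjoint_carrier[of U n n]
  by (simp add: conj_by_def mult_smult_distrib[of _ n n _ n] mult_smult_assoc_mat[of _ n n _ n])

lemma conj_by_hermitian:
  assumes "U \<in> carrier_mat n n" "M \<in> hermitian_mats n"
  shows "conj_by U M \<in> hermitian_mats n"
  using assms mat_adjoint_carrier[of U n n]
  by (auto simp: hermitian_mats_def conj_by_def mat_adjoint_mult[of _ n n _ n]
      assoc_mult_mat[of _ n n _ n _ n])

lemma unitary_mult:
  assumes "U \<in> unitary_mats n" "V \<in> unitary_mats n"
  shows "U * V \<in> unitary_mats n"
proof -
  have c: "U \<in> carrier_mat n n" "V \<in> carrier_mat n n"
    "mat_adjoint U \<in> carrier_mat n n" "mat_adjoint V \<in> carrier_mat n n"
    using assms mat_adjoint_carrier by (auto simp: unitary_mats_def)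
  have "mat_adjoint (U * V) * (U * V) = mat_adjoint V * (mat_adjoint U * U) * V"
    using c by (simp add: mat_adjoint_mult[of _ n n _ n] assoc_mult_mat[of _ n n _ n _ n])
  moreover have "U * V * mat_adjoint (U * V) = U * (V * mat_adjoint V) * mat_adjoint U"
    using c by (simp add: mat_adjoint_mult[of _ n n _ n] assoc_mult_mat[of _ n n _ n _ n])
  ultimately show ?thesis
    using assms c by (simp add: unitary_mats_def)
qed

lemma unitary_adjoint: "U \<in> unitary_mats n \<Longrightarrow> mat_adjoint U \<in> unitary_mats n"
  using mat_adjoint_carrier by (auto simp: unitary_mats_def)

lemma unitary_one: "1\<^sub>m n \<in> unitary_mats n"
  using mat_adjoint_mat_diag[of n "\<lambda>_. 1"] by (simp add: unitary_mats_def)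

text \<open>For square matrices a left inverse is also a right inverse.\<close>

lemma unitaryI:
  assumes "U \<in> carrier_mat n n" "mat_adjoint U * U = 1\<^sub>m n"
  shows "U \<in> unitary_mats n"
  using assms mat_mult_left_right_inverse[OF mat_adjoint_carrier[OF assms(1)] assms(1)]
  by (simp add: unitary_mats_def)

lemma conj_by_adjoint_cancel:
  assumes "U \<in> unitary_mats n" "M \<in> carrier_mat n n"
  shows "conj_by U (conj_by (mat_adjoint U) M) = M" "conj_by (mat_adjoint U) (conj_by U M) = M"
proof -
  have c: "U \<in> carrier_mat n n" "mat_adjoint U \<in> carrier_mat n n"
    using assms mat_adjoint_carrier by (auto simp: unitary_mats_def)
  have "mat_adjoint (1\<^sub>m n) = (1\<^sub>m n :: complex mat)"
    using mat_adjoint_mat_diag[of n "\<lambda>_. 1"] by simp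
  then show "conj_by U (conj_by (mat_adjoint U) M) = M" "conj_by (mat_adjoint U) (conj_by U M) = M"
    using assms c by (simp_all add: conj_by_conj_by[of _ n]) (simp_all add: unitary_mats_def conj_by_def)
qed

lemma rform_one_unitary:
  assumes "U \<in> unitary_mats n" "v \<in> carrier_vec n"
  shows "rform (1\<^sub>m n) (U *\<^sub>v v) = rform (1\<^sub>m n) v"
proof -
  have c: "mat_adjoint U \<in> carrier_mat n n"
    using assms mat_adjoint_carrier by (auto simp: unitary_mats_def)
  then have "conj_by (mat_adjoint U) (1\<^sub>m n) = 1\<^sub>m n"
    using assms by (auto simp: unitary_mats_def conj_by_def right_mult_one_mat[of _ n n])
  then show ?thesis
    using rform_conj_by[of "mat_adjoint U" n "1\<^sub>m n" v] assms c
    by (simp add: unitary_mats_def)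
qed

section \<open>The Loewner order through quadratic forms\<close>

lemma loewner_leI:
  assumes "X \<in> hermitian_mats n" "Y \<in> hermitian_mats n"
    "\<And>v. v \<in> carrier_vec n \<Longrightarrow> rform X v \<le> rform Y v"
  shows "loewner_le n X Y"
  using assms hermitian_diff[of Y n X] rform_diff[of Y n X]
  by (auto simp: loewner_le_def psd_mats_def rform_def[symmetric] hermitian_carrier)

lemma loewner_leD:
  assumes "loewner_le n X Y" "v \<in> carrier_vec n"
  shows "rform X v \<le> rform Y v"
  using assms rform_diff[of Y n X v]
  by (auto simp: loewner_le_def psd_mats_def rform_def[symmetric] hermitian_carrier)

lemma loewner_le_conj_by:
  assumes "loewner_le n X Y" "U \<in> carrier_mat n n"
  shows "loewner_le n (conj_by U X) (conj_by U Y)"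
proof (rule loewner_leI)
  have h: "X \<in> hermitian_mats n" "Y \<in> hermitian_mats n"
    using assms by (auto simp: loewner_le_def)
  then show "conj_by U X \<in> hermitian_mats n" "conj_by U Y \<in> hermitian_mats n"
    using assms conj_by_hermitian by auto
  fix v :: "complex vec" assume "v \<in> carrier_vec n"
  then show "rform (conj_by U X) v \<le> rform (conj_by U Y) v"
    using assms h mat_adjoint_carrier[of U n n]
    by (auto simp: rform_conj_by[of _ n] hermitian_carrier intro!: loewner_leD)
qed

text \<open>This carries the inequality for the convex function \<open>- f\<close> back to a concave
  \<open>f\<close>. The hypothesis makes only the negatives Hermitian; negating once more recovers
  \<open>X\<close> and \<open>Y\<close>. The factor is written \<open>complex_of_real (-1)\<close>
  so that the lemmas on real multiples apply.\<close>

lemma loewner_le_uminus: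
  assumes "loewner_le n (complex_of_real (-1) \<cdot>\<^sub>m X) (complex_of_real (-1) \<cdot>\<^sub>m Y)"
  shows "loewner_le n Y X"
proof -
  have *: "complex_of_real (-1) \<cdot>\<^sub>m (complex_of_real (-1) \<cdot>\<^sub>m M) = M" for M
    by (intro eq_matI) auto
  have h: "X \<in> hermitian_mats n" "Y \<in> hermitian_mats n"
    using assms hermitian_smult[of _ n "-1"] * unfolding loewner_le_def by metis+
  show ?thesis
    using h loewner_leD[OF assms]
    by (intro loewner_leI) (auto simp: rform_smult[of _ n] hermitian_carrier simp del: of_real_minus)
qed

section \<open>Spectral theorem for Hermitian matrices\<close>

text \<open>Complete \<open>v\<close> to a basis with \<open>v\<close> in front; Gram-Schmidt
  without normalization leaves the first vector unchanged.\<close>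

lemma corthogonal_list_with_head:
  fixes v :: "complex vec"
  assumes v: "v \<in> carrier_vec n" and v0: "v \<noteq> 0\<^sub>v n"
  obtains ws where "set ws \<subseteq> carrier_vec n" "corthogonal ws" "length ws = n" "ws ! 0 = v"
proof -
  interpret cof_vec_space n "TYPE(complex)" .
  define b where "b = basis_completion v"
  define ws where "ws = gram_schmidt n b"
  have n: "n \<noteq> 0" using v v0 by (auto intro!: eq_vecI)
  from basis_completion[OF v v0, folded b_def]
  have dist_b: "distinct b" and indep: "\<not> lin_dep (set b)" and b: "set b \<subseteq> carrier_vec n"
    and hdb: "hd b = v" and len_b: "length b = n" by auto
  from hdb len_b n obtain vs where bv: "b = v # vs" by (cases b) auto
  from gram_schmidt_result[OF b dist_b indep refl, folded ws_def]
  have ws: "set ws \<subseteq> carrier_vec n" "corthogonal ws" "length ws = n"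
    by (auto simp: len_b)
  have "ws \<noteq> []" using ws n by auto
  then have "ws ! 0 = v"
    using gram_schmidt_hd[OF v, of vs, folded bv] hd_conv_nth[of ws] by (simp add: ws_def)
  then show thesis using that ws by blast
qed

text \<open>The columns are the vectors of an orthogonal list starting with \<open>v\<close>, each
  divided by its norm; \<open>c\<close> is the reciprocal of the norm of \<open>v\<close>.\<close>

lemma unitary_with_first_col:
  fixes v :: "complex vec"
  assumes v: "v \<in> carrier_vec n" and v0: "v \<noteq> 0\<^sub>v n"
  obtains U c where "U \<in> unitary_mats n" "c \<noteq> 0" "col U 0 = c \<cdot>\<^sub>v v"
proof -
  have n: "n \<noteq> 0" using v v0 by (auto intro!: eq_vecI)
  obtain ws where ws: "set ws \<subseteq> carrier_vec n" "corthogonal ws" "length ws = n"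
    and hdws: "ws ! 0 = v"
    using corthogonal_list_with_head[OF v v0] by blast
  have wsi: "ws ! i \<in> carrier_vec n" if "i < n" for i using ws that by auto
  \<comment> \<open>The Euclidean norm of \<open>ws ! i\<close>. It is nonzero because
    \<open>corthogonal\<close> excludes zero vectors.\<close>
  define r where "r i = sqrt (rform (1\<^sub>m n) (ws ! i))" for i
  have sq: "ws ! i \<bullet>c ws ! i = (complex_of_real (r i))\<^sup>2" and r0: "r i \<noteq> 0" if "i < n" for i
  proof -
    have "ws ! i \<bullet>c ws ! i = complex_of_real (\<Sum>k<n. (cmod (ws ! i $ k))\<^sup>2)"
      unfolding of_real_sum complex_norm_square using wsi[OF that]
      by (simp add: scalar_prod_def lessThan_atLeast0)
    also have "(\<Sum>k<n. (cmod (ws ! i $ k))\<^sup>2) = (r i)\<^sup>2"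
      unfolding r_def rform_one[OF wsi[OF that]] by (simp add: sum_nonneg)
    finally show *: "ws ! i \<bullet>c ws ! i = (complex_of_real (r i))\<^sup>2" by simp
    have "ws ! i \<bullet>c ws ! i \<noteq> 0" using corthogonalD[OF ws(2)] ws that by auto
    then show "r i \<noteq> 0" unfolding * by auto
  qed
  define U where "U = mat n n (\<lambda>(i, j). ws ! j $ i / complex_of_real (r j))"
  have Uc: "U \<in> carrier_mat n n" by (simp add: U_def)
  have "mat_adjoint U * U = 1\<^sub>m n"
  proof (rule eq_matI)
    fix i j assume "i < dim_row (1\<^sub>m n)" "j < dim_col (1\<^sub>m n)"
    then have ij: "i < n" "j < n" by auto
    have "(mat_adjoint U * U) $$ (i, j) = (\<Sum>k<n. cnj (U $$ (k, i)) * U $$ (k, j))"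
      using ij Uc by (simp add: scalar_prod_def lessThan_atLeast0)
    also have "\<dots> = (\<Sum>k<n. cnj (ws ! i $ k / complex_of_real (r i)) * (ws ! j $ k / complex_of_real (r j)))"
      using ij by (intro sum.cong refl) (simp add: U_def)
    also have "\<dots> = (\<Sum>k<n. ws ! j $ k * cnj (ws ! i $ k)) / (complex_of_real (r i) * complex_of_real (r j))"
      unfolding sum_divide_distrib
      by (intro sum.cong refl) (simp only: complex_cnj_divide complex_cnj_complex_of_real
        times_divide_times_eq mult.commute[of "cnj _"])
    also have "(\<Sum>k<n. ws ! j $ k * cnj (ws ! i $ k)) = ws ! j \<bullet>c ws ! i"
      using wsi[OF ij(1)] wsi[OF ij(2)] by (simp add: scalar_prod_def lessThan_atLeast0)
    also have "\<dots> / (complex_of_real (r i) * complex_of_real (r j)) = 1\<^sub>m n $$ (i, j)"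
    proof (cases "i = j")
      case True
      then show ?thesis using sq[OF ij(1)] r0[OF ij(1)] ij by (simp add: power2_eq_square)
    next
      case False
      then have "ws ! j \<bullet>c ws ! i = 0" using corthogonalD[OF ws(2), of j i] ws(3) ij by simp
      then show ?thesis using False ij by simp
    qed
    finally show "(mat_adjoint U * U) $$ (i, j) = 1\<^sub>m n $$ (i, j)" .
  qed (use Uc in auto)
  then have "U \<in> unitary_mats n" using Uc unitaryI by blast
  moreover have "col U 0 = (1 / complex_of_real (r 0)) \<cdot>\<^sub>v v"
    using n v hdws by (intro eq_vecI) (auto simp: U_def)
  moreover have "1 / complex_of_real (r 0) \<noteq> 0" using r0[of 0] n by simp
  ultimately show thesis using that by blast
qed

lemma mat_adjoint_four_block_diag:
  fixes A B :: "complex mat"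
  assumes "A \<in> carrier_mat m m" "B \<in> carrier_mat n n"
  shows "mat_adjoint (four_block_mat A (0\<^sub>m m n) (0\<^sub>m n m) B)
    = four_block_mat (mat_adjoint A) (0\<^sub>m m n) (0\<^sub>m n m) (mat_adjoint B)"
  using assms by (intro eq_matI) auto

text \<open>Induction on the dimension by deflation. Conjugation moves an eigenvector into the first
  coordinate; the first column of the result is then zero below the diagonal, by symmetry so is the
  first row beyond it, and the remaining block is Hermitian of smaller size.\<close>

lemma hermitian_diagonalization:
  assumes "A \<in> hermitian_mats n"
  shows "\<exists>U\<in>unitary_mats n. \<exists>l. A = conj_by U (mat_diag n (\<lambda>i. complex_of_real (l i)))"
  using assms
proof (induction n arbitrary: A)
  case 0
  then show ?case
    using unitary_one[of 0] by (intro bexI[of _ "1\<^sub>m 0"] exI eq_matI)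
      (auto simp: hermitian_mats_def conj_by_def)
next
  case (Suc n)
  let ?N = "Suc n"
  have A: "A \<in> carrier_mat ?N ?N" using Suc.prems hermitian_carrier by blast
  obtain e where "eigenvalue A e"
    using spectrum_non_empty[OF A] by (auto simp: spectrum_def)
  then obtain v where v: "v \<in> carrier_vec ?N" "v \<noteq> 0\<^sub>v ?N" "A *\<^sub>v v = e \<cdot>\<^sub>v v"
    using A by (auto simp: eigenvalue_def eigenvector_def)
  obtain W c where W: "W \<in> unitary_mats ?N" and c: "col W 0 = c \<cdot>\<^sub>v v"
    using unitary_with_first_col[OF v(1,2)] by metis
  have Wc: "W \<in> carrier_mat ?N ?N" "mat_adjoint W \<in> carrier_mat ?N ?N"
    using W by (auto intro: unitary_carrier unitary_adjoint)
  define B where "B = conj_by (mat_adjoint W) A"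
  have B: "B \<in> hermitian_mats ?N" and Bc: "B \<in> carrier_mat ?N ?N"
    using conj_by_hermitian[OF Wc(2) Suc.prems] hermitian_carrier unfolding B_def by blast+
  have Bsym: "cnj (B $$ (j, i)) = B $$ (i, j)" if "i < ?N" "j < ?N" for i j
    using B that Bc mat_adjoint_index[of i B j] by (auto simp: hermitian_mats_def)
  have cmult: "x \<cdot>\<^sub>v (y \<cdot>\<^sub>v w) = y \<cdot>\<^sub>v (x \<cdot>\<^sub>v w)" for x y and w :: "complex vec"
    by (simp add: smult_smult_assoc mult.commute)
  \<comment> \<open>The first column of \<open>W\<close> is an eigenvector and is orthogonal to the
    other columns, so \<open>mat_adjoint W * A\<close> maps it to \<open>e\<close> times the first
    unit vector.\<close>
  have B0: "B $$ (i, 0) = (if i = 0 then e else 0)" if i: "i < ?N" for i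
  proof -
    have "A *\<^sub>v col W 0 = e \<cdot>\<^sub>v col W 0"
      unfolding c mult_mat_vec[OF A v(1)] v(3) by (rule cmult)
    then have "col (A * W) 0 = e \<cdot>\<^sub>v col W 0"
      using col_mult2[OF A Wc(1), of 0] by simp
    moreover have "B $$ (i, 0) = row (mat_adjoint W) i \<bullet> col (A * W) 0"
      using i A Wc unfolding B_def conj_by_def by (simp add: assoc_mult_mat[of _ ?N ?N _ ?N _ ?N])
    moreover have "row (mat_adjoint W) i \<bullet> col W 0 = (mat_adjoint W * W) $$ (i, 0)"
      using i Wc by (subst index_mult_mat) auto
    moreover have "(mat_adjoint W * W) $$ (i, 0) = (if i = 0 then 1 else 0)"
      using i W by (simp add: unitary_mats_def)
    ultimately show ?thesis
      using i Wc by (simp del: index_mult_mat)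
  qed
  define C where "C = mat n n (\<lambda>(i, j). B $$ (Suc i, Suc j))"
  have "C \<in> hermitian_mats n"
    unfolding hermitian_mats_def C_def using Bsym by (auto intro!: eq_matI)
  then obtain V l where V: "V \<in> unitary_mats n"
    and Cl: "C = conj_by V (mat_diag n (\<lambda>i. complex_of_real (l i)))"
    using Suc.IH by blast
  have Vc: "V \<in> carrier_mat n n" "mat_adjoint V \<in> carrier_mat n n"
    using V by (auto intro: unitary_carrier unitary_adjoint)
  \<comment> \<open>The eigenvalue that was split off goes in front of those of the smaller block
    \<open>C\<close>.\<close>
  define m where "m i = (case i of 0 \<Rightarrow> Re e | Suc k \<Rightarrow> l k)" for i
  \<comment> \<open>The eigenvalue is real, being a diagonal entry of the Hermitian matrix
    \<open>B\<close>.\<close>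
  have "cnj e = e" using Bsym[of 0 0] B0[of 0] by simp
  then have e: "complex_of_real (Re e) = e" by (simp add: complex_eq_iff)
  let ?fb = "\<lambda>X Y. four_block_mat X (0\<^sub>m 1 n) (0\<^sub>m n 1) (Y :: complex mat)"
  \<comment> \<open>The unitary of the smaller block, extended by the identity on the first
    coordinate; it diagonalizes \<open>B\<close>.\<close>
  define Z where "Z = ?fb (1\<^sub>m 1) V"
  have mult: "?fb X Y * ?fb X' Y' = ?fb (X * X') (Y * Y')"
    if "X \<in> carrier_mat 1 1" "Y \<in> carrier_mat n n" "X' \<in> carrier_mat 1 1" "Y' \<in> carrier_mat n n"
    for X Y X' Y'
    using that by (subst mult_four_block_mat[of _ 1 1 _ n _ n _ _ 1 _ n]) auto
  have one: "mat_adjoint (1\<^sub>m 1) = (1\<^sub>m 1 :: complex mat)"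
    using mat_adjoint_mat_diag[of 1 "\<lambda>_. 1"] by simp
  have Zadj: "mat_adjoint Z = ?fb (1\<^sub>m 1) (mat_adjoint V)"
    unfolding Z_def using mat_adjoint_four_block_diag[of "1\<^sub>m 1" 1 V n] Vc one by simp
  have fb1: "?fb (1\<^sub>m 1) (1\<^sub>m n) = 1\<^sub>m ?N"
    by (intro eq_matI) auto
  have Zc: "Z \<in> carrier_mat ?N ?N"
    unfolding Z_def using four_block_carrier_mat[of "1\<^sub>m 1" 1 1 V n n] Vc by simp
  have "mat_adjoint Z * Z = 1\<^sub>m ?N"
    unfolding Zadj unfolding Z_def mult[OF one_carrier_mat Vc(2) one_carrier_mat Vc(1)]
    using V fb1 by (simp add: unitary_mats_def)
  then have Z: "Z \<in> unitary_mats ?N" using Zc unitaryI by blast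
  have D: "mat_diag ?N (\<lambda>i. complex_of_real (m i))
      = ?fb (mat 1 1 (\<lambda>_. e)) (mat_diag n (\<lambda>i. complex_of_real (l i)))"
    using e by (intro eq_matI) (auto simp: mat_diag_def m_def split: nat.splits)
  have "B = ?fb (mat 1 1 (\<lambda>_. e)) C"
  proof (rule eq_matI)
    fix i j
    assume "i < dim_row (?fb (mat 1 1 (\<lambda>_. e)) C)" "j < dim_col (?fb (mat 1 1 (\<lambda>_. e)) C)"
    then have "i < ?N" "j < ?N" by (auto simp: C_def)
    then show "B $$ (i, j) = ?fb (mat 1 1 (\<lambda>_. e)) C $$ (i, j)"
      using B0[of i] B0[of j] Bsym[of j 0]
      by (cases i; cases j) (auto simp: C_def)
  qed (use Bc in \<open>auto simp: C_def\<close>)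
  also have "\<dots> = conj_by Z (mat_diag ?N (\<lambda>i. complex_of_real (m i)))"
  proof -
    have c: "1\<^sub>m 1 * mat 1 1 (\<lambda>_. e) \<in> carrier_mat 1 1" "mat 1 1 (\<lambda>_. e) \<in> carrier_mat 1 1"
      "V * mat_diag n (\<lambda>i. complex_of_real (l i)) \<in> carrier_mat n n"
      using Vc by auto
    show ?thesis
      unfolding conj_by_def Zadj D Cl unfolding Z_def
        mult[OF one_carrier_mat Vc(1) c(2) mat_diag_dim] mult[OF c(1,3) one_carrier_mat Vc(2)]
      using c by simp
  qed
  finally have "A = conj_by (W * Z) (mat_diag ?N (\<lambda>i. complex_of_real (m i)))"
    using conj_by_adjoint_cancel(1)[OF W A] conj_by_conj_by[OF Wc(1) Zc mat_diag_dim]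
    unfolding B_def by simp
  then show ?case using unitary_mult[OF W Z] by blast
qed

section \<open>Eigenvalue domination\<close>

text \<open>The permutation is the list of indices sorted by the key \<open>- c\<close>, read as a
  function.\<close>

lemma permutation_sorting_decreasing:
  fixes c :: "nat \<Rightarrow> real"
  obtains p where "bij_betw p {..<n} {..<n}" "\<And>i j. i \<le> j \<Longrightarrow> j < n \<Longrightarrow> c (p j) \<le> c (p i)"
proof -
  define xs where "xs = sort_key (\<lambda>i. - c i) [0..<n]"
  have xs: "length xs = n" "set xs = {..<n}" "distinct xs" "sorted (map (\<lambda>i. - c i) xs)"
    unfolding xs_def using sorted_sort_key[of "\<lambda>i. - c i" "[0..<n]"]
    by (simp_all add: lessThan_atLeast0)
  have "bij_betw ((!) xs) {..<n} {..<n}"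
    by (rule bij_betw_nth[OF xs(3)]) (simp_all only: xs(1,2))
  moreover have "c (xs ! j) \<le> c (xs ! i)" if "i \<le> j" "j < n" for i j
    using sorted_nth_mono[OF xs(4), of i j] that xs(1) by simp
  ultimately show thesis using that by blast
qed

text \<open>These are \<open>n - 1\<close> homogeneous linear equations in \<open>n\<close>
  unknowns. A zero row in the free slot \<open>k\<close> makes the system square and
  singular.\<close>

lemma nonzero_vec_with_conditions:
  fixes R :: "nat \<Rightarrow> complex vec"
  assumes "k < n" and "\<And>i. i < n \<Longrightarrow> R i \<in> carrier_vec n"
  obtains h where "h \<in> carrier_vec n" "h \<noteq> 0\<^sub>v n" "\<And>i. i < n \<Longrightarrow> i \<noteq> k \<Longrightarrow> R i \<bullet> h = 0"
proof -
  define M where "M = mat\<^sub>r n n (\<lambda>i. if i = k then 0\<^sub>v n else R i)"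
  have M: "M \<in> carrier_mat n n" by (simp add: M_def)
  have "det M = 0" unfolding M_def using det_row_0[of k n R] assms by auto
  then obtain h where h: "h \<in> carrier_vec n" "h \<noteq> 0\<^sub>v n" "M *\<^sub>v h = 0\<^sub>v n"
    using det_0_iff_vec_prod_zero[OF M] by blast
  have "R i \<bullet> h = 0" if "i < n" "i \<noteq> k" for i
  proof -
    have "R i \<bullet> h = (M *\<^sub>v h) $ i" using that assms M by (simp add: M_def)
    also have "\<dots> = 0" using h that by simp
    finally show ?thesis .
  qed
  then show thesis using that h by blast
qed

text \<open>
  Both sequences are enumerated decreasingly. The vectors supported on the first \<open>k + 1\<close>
  coordinates meet the span of the eigenvectors from the \<open>k\<close>-th on, and comparing the
  quadratic form there with the two extreme values gives the inequality of the \<open>k\<close>-th entries.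
\<close>

lemma loewner_le_conj_by_of_support_bound:
  assumes Y: "Y \<in> hermitian_mats n"
    and bound: "\<And>m h. h \<in> carrier_vec n \<Longrightarrow> (\<And>i. i < n \<Longrightarrow> h $ i \<noteq> 0 \<Longrightarrow> m \<le> c i) \<Longrightarrow>
      m * rform (1\<^sub>m n) h \<le> rform Y h"
  shows "\<exists>U\<in>unitary_mats n. loewner_le n (mat_diag n (\<lambda>i. complex_of_real (c i))) (conj_by U Y)"
proof -
  obtain Q y where Q: "Q \<in> unitary_mats n"
    and Yd: "Y = conj_by Q (mat_diag n (\<lambda>i. complex_of_real (y i)))"
    using hermitian_diagonalization[OF Y] by blast
  have Qc: "Q \<in> carrier_mat n n" "mat_adjoint Q \<in> carrier_mat n n"
    using Q by (auto intro: unitary_carrier unitary_adjoint)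
  obtain p where p: "bij_betw p {..<n} {..<n}"
    and p_mono: "\<And>i j. i \<le> j \<Longrightarrow> j < n \<Longrightarrow> c (p j) \<le> c (p i)"
    using permutation_sorting_decreasing by blast
  obtain q where q: "bij_betw q {..<n} {..<n}"
    and q_mono: "\<And>i j. i \<le> j \<Longrightarrow> j < n \<Longrightarrow> y (q j) \<le> y (q i)"
    using permutation_sorting_decreasing by blast
  note perm = bij_betw_apply[of _ "{..<n}" "{..<n}", unfolded lessThan_iff]
    bij_betw_imp_surj_on[of _ "{..<n}" "{..<n}", unfolded set_eq_iff image_iff lessThan_iff Bex_def]
  have pn: "p i < n" and qn: "q i < n" if "i < n" for i
    using perm(1)[OF p that] perm(1)[OF q that] .
  have p_surj: "\<exists>j<n. i = p j" and q_surj: "\<exists>j<n. i = q j" if "i < n" for i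
    using perm(2)[OF p] perm(2)[OF q] that by blast+
  have le: "c (p k) \<le> y (q k)" if k: "k < n" for k
  proof -
    \<comment> \<open>The conditions before \<open>k\<close> make \<open>h\<close> orthogonal to the
      eigenvectors of the \<open>k\<close> largest eigenvalues of \<open>Y\<close>; those after
      \<open>k\<close> make the coordinates of \<open>h\<close> with the smaller values of
      \<open>c\<close> vanish. Slot \<open>k\<close> is left free, so a nonzero \<open>h\<close>
      remains.\<close>
    define R where "R i = (if i < k then row (mat_adjoint Q) (q i) else unit_vec n (p i))" for i
    have "R i \<in> carrier_vec n" if "i < n" for i
      using that Qc by (auto simp: R_def intro: carrier_vecI)
    then obtain h where h: "h \<in> carrier_vec n" "h \<noteq> 0\<^sub>v n"
      and R0: "\<And>i. i < n \<Longrightarrow> i \<noteq> k \<Longrightarrow> R i \<bullet> h = 0"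
      using nonzero_vec_with_conditions[OF k] by blast
    \<comment> \<open>The coordinates of \<open>h\<close> in the eigenbasis of
      \<open>Y\<close>.\<close>
    define g where "g = mat_adjoint Q *\<^sub>v h"
    have g: "g \<in> carrier_vec n" using Qc h by (simp add: g_def)
    have g0: "g $ (q i) = 0" if "i < k" for i
      using R0[of i] that k qn[of i] Qc by (simp add: R_def g_def)
    have h0: "h $ (p i) = 0" if "k < i" "i < n" for i
      using R0[of i] that pn[of i] h by (simp add: R_def)
    have "c (p k) * rform (1\<^sub>m n) h \<le> rform Y h"
    proof (rule bound[OF h(1)])
      fix i assume i: "i < n" "h $ i \<noteq> 0"
      then obtain j where j: "j < n" "i = p j" using p_surj by blast
      then have "j \<le> k" using h0[of j] i by (cases "j \<le> k") auto
      then show "c (p k) \<le> c i" using p_mono[of j k] k j by simp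
    qed
    also have "rform Y h = (\<Sum>i<n. y i * (cmod (g $ i))\<^sup>2)"
      unfolding Yd rform_conj_by[OF Qc(1) mat_diag_dim h(1)] g_def[symmetric]
        rform_mat_diag[OF g] ..
    also have "\<dots> \<le> (\<Sum>i<n. y (q k) * (cmod (g $ i))\<^sup>2)"
    proof (rule sum_mono)
      fix i assume i: "i \<in> {..<n}"
      then obtain j where j: "j < n" "i = q j" using q_surj[of i] by auto
      show "y i * (cmod (g $ i))\<^sup>2 \<le> y (q k) * (cmod (g $ i))\<^sup>2"
      proof (cases "j < k")
        case True
        then show ?thesis using g0 j by simp
      next
        case False
        then show ?thesis using q_mono[of k j] j by (intro mult_right_mono) auto
      qed
    qed
    also have "\<dots> = y (q k) * rform (1\<^sub>m n) h"
      using rform_one_unitary[OF unitary_adjoint[OF Q] h(1)]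
      unfolding g_def[symmetric] rform_one[OF g] sum_distrib_left[symmetric] by simp
    finally show ?thesis
      using rform_one_pos[OF h] by simp
  qed
  \<comment> \<open>Matches the index of the \<open>j\<close>-th largest value of \<open>c\<close>
    with the index of the \<open>j\<close>-th largest eigenvalue of \<open>Y\<close>.\<close>
  define t where "t = q \<circ> the_inv_into {..<n} p"
  have t: "bij_betw t {..<n} {..<n}"
    unfolding t_def using bij_betw_trans[OF bij_betw_the_inv_into[OF p] q] .
  have tn: "t i < n" if "i < n" for i using perm(1)[OF t that] .
  have t_le: "c i \<le> y (t i)" if i: "i < n" for i
  proof -
    obtain j where j: "j < n" "i = p j" using p_surj i by blast
    then have "t i = q j"
      unfolding t_def using the_inv_into_f_f[OF bij_betw_imp_inj_on[OF p], of j] by simp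
    then show ?thesis using le[OF j(1)] j by simp
  qed
  \<comment> \<open>The permutation matrix of \<open>t\<close>; conjugation by it reorders diagonal
    entries.\<close>
  define P :: "complex mat" where "P = mat n n (\<lambda>(i, j). if j = t i then 1 else 0)"
  have Pc: "P \<in> carrier_mat n n" by (simp add: P_def)
  have Pdiag: "conj_by P (mat_diag n f) = mat_diag n (\<lambda>i. f (t i))" for f
  proof (rule eq_matI)
    fix i j assume "i < dim_row (mat_diag n (\<lambda>i. f (t i)))" "j < dim_col (mat_diag n (\<lambda>i. f (t i)))"
    then have ij: "i < n" "j < n" by (auto simp: mat_diag_def)
    have "conj_by P (mat_diag n f) $$ (i, j) = (\<Sum>k<n. P $$ (i, k) * f k * cnj (P $$ (j, k)))"
      unfolding conj_by_def mat_diag_mult_right[OF Pc]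
      using ij Pc by (simp add: scalar_prod_def lessThan_atLeast0)
    also have "\<dots> = (\<Sum>k<n. (if k = t i then 1 else 0) * f k * (if k = t j then 1 else 0))"
      using ij by (intro sum.cong refl) (simp add: P_def)
    also have "\<dots> = (\<Sum>k<n. if k = t i then f k * (if k = t j then 1 else 0) else 0)"
      by (intro sum.cong) auto
    also have "\<dots> = f (t i) * (if t i = t j then 1 else 0)"
      using tn ij by simp
    also have "\<dots> = mat_diag n (\<lambda>i. f (t i)) $$ (i, j)"
      using ij bij_betw_imp_inj_on[OF t] by (auto simp: mat_diag_def inj_on_def)
    finally show "conj_by P (mat_diag n f) $$ (i, j) = mat_diag n (\<lambda>i. f (t i)) $$ (i, j)" .
  qed (use Pc in \<open>auto simp: conj_by_def mat_diag_def\<close>)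
  \<comment> \<open>The identity matrix is the constant diagonal, so \<open>Pdiag\<close> already
    contains this half of unitarity. As \<open>unitaryI\<close> asks for the other half, it is
    applied to the adjoint of \<open>P\<close>.\<close>
  have "P * mat_adjoint P = 1\<^sub>m n"
    using Pdiag[of "\<lambda>_. 1"] Pc by (simp add: conj_by_def)
  then have "mat_adjoint P \<in> unitary_mats n"
    using unitaryI[of "mat_adjoint P" n] mat_adjoint_carrier[OF Pc] by simp
  then have P: "P \<in> unitary_mats n" using unitary_adjoint by fastforce
  define U where "U = P * mat_adjoint Q"
  have "U \<in> unitary_mats n"
    unfolding U_def using unitary_mult[OF P unitary_adjoint[OF Q]] .
  moreover have "conj_by U Y = mat_diag n (\<lambda>i. complex_of_real (y (t i)))"
    using conj_by_conj_by[OF Pc Qc(2) hermitian_carrier[OF Y]]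
      conj_by_adjoint_cancel(2)[OF Q mat_diag_dim, of "\<lambda>i. complex_of_real (y i)"]
      Pdiag[of "\<lambda>i. complex_of_real (y i)"]
    unfolding U_def by (simp only: Yd[symmetric])
  moreover have "loewner_le n (mat_diag n (\<lambda>i. complex_of_real (c i)))
      (mat_diag n (\<lambda>i. complex_of_real (y (t i))))"
    using t_le
    by (intro loewner_leI mat_diag_hermitian)
      (simp add: rform_mat_diag, intro sum_mono mult_right_mono, simp_all)
  ultimately show ?thesis by (intro bexI[of _ U]) simp_all
qed

section \<open>Jensen's inequality for positive maps\<close>

lemma psd_conj_by_mat_diag:
  assumes U: "U \<in> carrier_mat n n" and c: "\<And>i. i < n \<Longrightarrow> 0 \<le> c i"
  shows "conj_by U (mat_diag n (\<lambda>i. complex_of_real (c i))) \<in> psd_mats n"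
proof -
  have "0 \<le> rform (conj_by U (mat_diag n (\<lambda>i. complex_of_real (c i)))) v"
    if v: "v \<in> carrier_vec n" for v
  proof -
    have g: "mat_adjoint U *\<^sub>v v \<in> carrier_vec n"
      using mat_adjoint_carrier[OF U] v by simp
    show ?thesis
      unfolding rform_conj_by[OF U mat_diag_dim v] rform_mat_diag[OF g]
      by (intro sum_nonneg mult_nonneg_nonneg) (use c in auto)
  qed
  then show ?thesis
    using conj_by_hermitian[OF U mat_diag_hermitian[of n c]]
    by (auto simp: psd_mats_def rform_def[symmetric])
qed

lemma psd_hermitian: "A \<in> psd_mats n \<Longrightarrow> A \<in> hermitian_mats n"
  by (simp add: psd_mats_def)

lemma unital_positive_linear_mapD:
  assumes "unital_positive_linear_map n d \<Phi>"
  shows "\<Phi> (1\<^sub>m n) = 1\<^sub>m d"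
    and "X \<in> psd_mats n \<Longrightarrow> \<Phi> X \<in> psd_mats d"
    and "X \<in> carrier_mat n n \<Longrightarrow> Y \<in> carrier_mat n n \<Longrightarrow> \<Phi> (X + Y) = \<Phi> X + \<Phi> Y"
    and "X \<in> carrier_mat n n \<Longrightarrow> \<Phi> (c \<cdot>\<^sub>m X) = c \<cdot>\<^sub>m \<Phi> X"
  using assms unfolding unital_positive_linear_map_def linear_mat_map_def by auto

text \<open>Linearity of \<open>\<Phi>\<close> is stated for two summands, so the diagonal entries
  are added one at a time. The image being Hermitian is carried along because it supplies the
  dimensions needed to split the form.\<close>

lemma positive_map_conj_by_mat_diag_aux:
  fixes a :: "nat \<Rightarrow> real"
  assumes \<Phi>: "unital_positive_linear_map n d \<Phi>" and P: "P \<in> carrier_mat n n"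
    and h: "h \<in> carrier_vec d"
  shows "k \<le> n \<Longrightarrow>
    \<Phi> (conj_by P (mat_diag n (\<lambda>j. complex_of_real (if j < k then a j else 0)))) \<in> hermitian_mats d \<and>
    rform (\<Phi> (conj_by P (mat_diag n (\<lambda>j. complex_of_real (if j < k then a j else 0))))) h
      = (\<Sum>i<k. a i * rform (\<Phi> (conj_by P (mat_diag n (\<lambda>j. complex_of_real (of_bool (j = i)))))) h)"
proof (induction k)
  case 0
  let ?X = "conj_by P (mat_diag n (\<lambda>j. complex_of_real 1))"
  have X: "?X \<in> carrier_mat n n" using P by simp
  have \<Phi>X: "\<Phi> ?X \<in> hermitian_mats d"
    by (intro psd_hermitian unital_positive_linear_mapD(2)[OF \<Phi>] psd_conj_by_mat_diag P) simp
  \<comment> \<open>The zero matrix is a multiple of a positive semi-definite one, so homogeneity of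
    \<open>\<Phi>\<close> settles the empty sum.\<close>
  have "mat_diag n (\<lambda>j. complex_of_real (if j < 0 then a j else 0))
      = complex_of_real 0 \<cdot>\<^sub>m mat_diag n (\<lambda>j. complex_of_real 1)"
    by (intro eq_matI) (auto simp: mat_diag_def)
  then have eq: "\<Phi> (conj_by P (mat_diag n (\<lambda>j. complex_of_real (if j < 0 then a j else 0))))
      = complex_of_real 0 \<cdot>\<^sub>m \<Phi> ?X"
    by (simp only: conj_by_smult[OF P mat_diag_dim] unital_positive_linear_mapD(4)[OF \<Phi> X])
  show ?case
    unfolding eq rform_smult[OF hermitian_carrier[OF \<Phi>X] h]
    using hermitian_smult[OF \<Phi>X] by (simp del: of_real_0)
next
  case (Suc k)
  let ?D = "\<lambda>k. mat_diag n (\<lambda>j. complex_of_real (if j < k then a j else 0))"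
  let ?E = "mat_diag n (\<lambda>j. complex_of_real (of_bool (j = k)))"
  have D: "conj_by P (?D k) \<in> carrier_mat n n" and E: "conj_by P ?E \<in> carrier_mat n n"
    using P by simp_all
  have \<Phi>E: "\<Phi> (conj_by P ?E) \<in> hermitian_mats d"
    by (intro psd_hermitian unital_positive_linear_mapD(2)[OF \<Phi>] psd_conj_by_mat_diag P) simp
  have IH: "\<Phi> (conj_by P (?D k)) \<in> hermitian_mats d"
    "rform (\<Phi> (conj_by P (?D k))) h
      = (\<Sum>i<k. a i * rform (\<Phi> (conj_by P (mat_diag n (\<lambda>j. complex_of_real (of_bool (j = i)))))) h)"
    using Suc by auto
  have "?D (Suc k) = ?D k + complex_of_real (a k) \<cdot>\<^sub>m ?E"
    by (intro eq_matI) (auto simp: mat_diag_def less_Suc_eq)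
  then have "conj_by P (?D (Suc k)) = conj_by P (?D k) + complex_of_real (a k) \<cdot>\<^sub>m conj_by P ?E"
    using conj_by_add[OF P mat_diag_dim, of "complex_of_real (a k) \<cdot>\<^sub>m ?E"]
      conj_by_smult[OF P mat_diag_dim] by simp
  then have eq: "\<Phi> (conj_by P (?D (Suc k)))
      = \<Phi> (conj_by P (?D k)) + complex_of_real (a k) \<cdot>\<^sub>m \<Phi> (conj_by P ?E)"
    using D E by (simp only: unital_positive_linear_mapD(3,4)[OF \<Phi>] smult_carrier_mat)
  have s: "complex_of_real (a k) \<cdot>\<^sub>m \<Phi> (conj_by P ?E) \<in> hermitian_mats d"
    using hermitian_smult[OF \<Phi>E] .
  show ?case
    unfolding eq rform_add[OF hermitian_carrier[OF IH(1)] hermitian_carrier[OF s] h]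
      rform_smult[OF hermitian_carrier[OF \<Phi>E] h] IH(2)
    using hermitian_add[OF IH(1) s] by simp
qed

text \<open>For unitary \<open>P\<close> the matrices built from \<open>of_bool\<close> are the
  eigenprojections. Their images are positive semi-definite, and a real combination of such matrices
  is Hermitian.\<close>

lemma positive_map_conj_by_mat_diag:
  fixes a :: "nat \<Rightarrow> real"
  assumes \<Phi>: "unital_positive_linear_map n d \<Phi>" and P: "P \<in> carrier_mat n n"
  shows "\<Phi> (conj_by P (mat_diag n (\<lambda>j. complex_of_real (a j)))) \<in> hermitian_mats d"
    and "h \<in> carrier_vec d \<Longrightarrow> rform (\<Phi> (conj_by P (mat_diag n (\<lambda>j. complex_of_real (a j))))) h
      = (\<Sum>i<n. a i * rform (\<Phi> (conj_by P (mat_diag n (\<lambda>j. complex_of_real (of_bool (j = i)))))) h)"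
proof -
  have eq: "mat_diag n (\<lambda>j. complex_of_real (if j < n then a j else 0))
      = mat_diag n (\<lambda>j. complex_of_real (a j))"
    by (intro eq_matI) (auto simp: mat_diag_def)
  note aux = positive_map_conj_by_mat_diag_aux[OF \<Phi> P _ order_refl, of _ a, unfolded eq]
  show "\<Phi> (conj_by P (mat_diag n (\<lambda>j. complex_of_real (a j)))) \<in> hermitian_mats d"
    using aux[OF zero_carrier_vec] by blast
  show "h \<in> carrier_vec d \<Longrightarrow> rform (\<Phi> (conj_by P (mat_diag n (\<lambda>j. complex_of_real (a j))))) h
      = (\<Sum>i<n. a i * rform (\<Phi> (conj_by P (mat_diag n (\<lambda>j. complex_of_real (of_bool (j = i)))))) h)"
    using aux by blast
qed

text \<open>The weights \<open>w i / N\<close> are nonnegative since \<open>\<Phi>\<close> is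
  positive and sum to 1 since it is unital. Thus \<open>x\<close> is a convex combination of the
  \<open>a i\<close>, and scalar Jensen applies.\<close>

lemma positive_map_jensen:
  fixes a :: "nat \<Rightarrow> real"
  assumes \<Phi>: "unital_positive_linear_map n d \<Phi>" and P: "P \<in> unitary_mats n"
    and f: "convex_on \<Omega> f" and a: "\<And>i. i < n \<Longrightarrow> a i \<in> \<Omega>"
    and h: "h \<in> carrier_vec d" "h \<noteq> 0\<^sub>v d"
  defines "x \<equiv> rform (\<Phi> (conj_by P (mat_diag n (\<lambda>j. complex_of_real (a j))))) h / rform (1\<^sub>m d) h"
  shows "x \<in> \<Omega>"
    and "f x * rform (1\<^sub>m d) h \<le> rform (\<Phi> (conj_by P (mat_diag n (\<lambda>j. complex_of_real (f (a j)))))) h"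
proof -
  have Pc: "P \<in> carrier_mat n n" using P by (rule unitary_carrier)
  define N where "N = rform (1\<^sub>m d) h"
  have N: "N > 0" unfolding N_def using rform_one_pos[OF h] .
  define w where "w i = rform (\<Phi> (conj_by P (mat_diag n (\<lambda>j. complex_of_real (of_bool (j = i)))))) h" for i
  note form = positive_map_conj_by_mat_diag(2)[OF \<Phi> Pc h(1), folded w_def]
  have w: "w i \<ge> 0" for i
  proof -
    have "\<Phi> (conj_by P (mat_diag n (\<lambda>j. complex_of_real (of_bool (j = i))))) \<in> psd_mats d"
      by (intro unital_positive_linear_mapD(2)[OF \<Phi>] psd_conj_by_mat_diag Pc) simp
    then show ?thesis using h unfolding w_def rform_def psd_mats_def by blast
  qed
  have "conj_by P (mat_diag n (\<lambda>j. complex_of_real 1)) = 1\<^sub>m n"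
    using P right_mult_one_mat[OF Pc] by (simp add: conj_by_def unitary_mats_def)
  then have wN: "(\<Sum>i<n. w i) = N"
    using form[of "\<lambda>_. 1"] unital_positive_linear_mapD(1)[OF \<Phi>] by (simp add: N_def)
  have u: "(\<Sum>i<n. w i / N) = 1" "\<And>i. 0 \<le> w i / N"
    using wN N w by (simp_all add: sum_divide_distrib[symmetric])
  \<comment> \<open>The weights have the positive sum \<open>N\<close>, so there is at least one of
    them.\<close>
  have ne: "{..<n} \<noteq> {}" using wN N by (cases "{..<n} = {}") auto
  have x: "x = (\<Sum>i<n. (w i / N) *\<^sub>R a i)"
    unfolding x_def form N_def[symmetric] by (simp add: sum_divide_distrib mult.commute)
  show "x \<in> \<Omega>"
    unfolding x by (rule convex_sum) (use u a convex_on_imp_convex[OF f] in auto)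
  have "f x \<le> (\<Sum>i<n. (w i / N) * f (a i))"
    unfolding x by (rule convex_on_sum[OF _ ne f u(1)]) (use u a in auto)
  then have "f x * N \<le> (\<Sum>i<n. (w i / N) * f (a i)) * N"
    using N by (intro mult_right_mono) auto
  also have "\<dots> = (\<Sum>i<n. f (a i) * w i)"
    unfolding sum_distrib_right using N by (intro sum.cong) auto
  finally show "f x * rform (1\<^sub>m d) h
      \<le> rform (\<Phi> (conj_by P (mat_diag n (\<lambda>j. complex_of_real (f (a j)))))) h"
    unfolding form N_def .
qed

section \<open>Shape of convex functions on the line\<close>

text \<open>On a segment \<open>f\<close> is at most the larger of its two end values; this excludes
  a rise before \<open>p\<close> together with a drop after it. The split is stated at a given point
  because \<open>f\<close> need not attain a minimum.\<close>

lemma convex_on_antimono_or_mono: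
  fixes f :: "real \<Rightarrow> real"
  assumes f: "convex_on \<Omega> f" and p: "p \<in> \<Omega>"
  shows "antimono_on (\<Omega> \<inter> {..p}) f \<or> mono_on (\<Omega> \<inter> {p..}) f"
proof -
  have max: "f t \<le> max (f x) (f y)" if "x \<in> \<Omega>" "y \<in> \<Omega>" "x \<le> t" "t \<le> y" for x y t
  proof (cases "x = y")
    case True
    then have "t = x" using that by simp
    then show ?thesis by simp
  next
    case False
    then have xy: "x < y" using that by simp
    define u where "u = (t - x) / (y - x)"
    have u: "0 \<le> u" "u \<le> 1" using that xy by (auto simp: u_def divide_simps)
    have "u * (y - x) = t - x" using xy by (simp add: u_def)
    then have t: "t = (1 - u) *\<^sub>R x + u *\<^sub>R y" by (simp add: algebra_simps)
    have "f t \<le> (1 - u) * f x + u * f y"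
      unfolding t by (rule convex_onD[OF f u that(1,2)])
    also have "\<dots> \<le> (1 - u) * max (f x) (f y) + u * max (f x) (f y)"
      using u by (intro add_mono mult_left_mono) auto
    finally show ?thesis by (simp add: algebra_simps)
  qed
  show ?thesis
  proof (rule disjCI)
    assume "\<not> mono_on (\<Omega> \<inter> {p..}) f"
    then obtain u v where uv: "u \<in> \<Omega>" "v \<in> \<Omega>" "p \<le> u" "u \<le> v" "f v < f u"
      by (auto simp: monotone_on_def not_le)
    \<comment> \<open>As \<open>u\<close> lies between \<open>x\<close> and \<open>v\<close> and
      \<open>f v < f u\<close>, it follows that \<open>f u \<le> f x\<close>. As \<open>y\<close>
      lies between \<open>x\<close> and \<open>u\<close>, its value is then at most
      \<open>f x\<close> too.\<close>
    have "f y \<le> f x" if "x \<in> \<Omega>" "y \<in> \<Omega>" "x \<le> y" "y \<le> p" for x y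
      using max[of x v u] max[of x u y] max[of y v u] that uv by (simp add: le_max_iff_disj)
    then show "antimono_on (\<Omega> \<inter> {..p}) f" by (auto simp: monotone_on_def)
  qed
qed

section \<open>Functional calculus through a diagonalization\<close>

lemma mat_fun_conj_by:
  assumes U: "U \<in> unitary_mats n"
  shows "mat_fun f (conj_by U (mat_diag n (\<lambda>i. complex_of_real (l i))))
    = conj_by U (mat_diag n (\<lambda>i. complex_of_real (f (l i))))"
proof -
  have dim: "dim_row (conj_by U (mat_diag n (\<lambda>i. complex_of_real (l i)))) = n"
    using conj_by_carrier[OF unitary_carrier[OF U] mat_diag_dim] by blast
  have "diagonalizes (conj_by U (mat_diag n (\<lambda>i. complex_of_real (l i)))) U l"
    unfolding diagonalizes_def dim using U by (simp add: conj_by_def)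
  from mat_fun_eqI[OF this, of f] show ?thesis unfolding dim by (simp add: conj_by_def)
qed

text \<open>The columns of \<open>P\<close> are nonzero eigenvectors, so every diagonal entry
  belongs to the spectrum.\<close>

lemma hermitian_mats_in_diagonal:
  assumes A: "A \<in> hermitian_mats_in n \<Omega>" and P: "P \<in> unitary_mats n"
    and AP: "A = conj_by P (mat_diag n (\<lambda>i. complex_of_real (a i)))" and i: "i < n"
  shows "a i \<in> \<Omega>"
proof -
  have Pc: "P \<in> carrier_mat n n" "mat_adjoint P \<in> carrier_mat n n"
    using P by (auto intro: unitary_carrier unitary_adjoint)
  have Ac: "A \<in> carrier_mat n n"
    using A by (simp add: hermitian_mats_in_def hermitian_carrier)
  let ?D = "mat_diag n (\<lambda>i. complex_of_real (a i))"
  have "A * P = P * ?D * (mat_adjoint P * P)"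
    unfolding AP conj_by_def using assoc_mult_mat[of "P * ?D" n n _ n P n] Pc by simp
  also have "\<dots> = P * ?D"
    using P right_mult_one_mat[of "P * ?D" n n] Pc by (simp add: unitary_mats_def)
  finally have "A *\<^sub>v col P i = col (P * ?D) i"
    using col_mult2[OF Ac Pc(1) i] by simp
  also have "\<dots> = complex_of_real (a i) \<cdot>\<^sub>v col P i"
    unfolding mat_diag_mult_right[OF Pc(1)] using i Pc by (intro eq_vecI) auto
  finally have ev: "A *\<^sub>v col P i = complex_of_real (a i) \<cdot>\<^sub>v col P i" .
  have "col P i \<noteq> 0\<^sub>v n"
  proof
    assume "col P i = 0\<^sub>v n"
    then have "(mat_adjoint P * P) $$ (i, i) = 0"
      using i Pc by (subst index_mult_mat) auto
    then show False using P i by (simp add: unitary_mats_def)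
  qed
  moreover have "dim_row A = n" "col P i \<in> carrier_vec n"
    using Ac Pc by (auto intro: carrier_vecI)
  ultimately have "eigenvector A (col P i) (complex_of_real (a i))"
    using ev unfolding eigenvector_def by blast
  then have "complex_of_real (a i) \<in> spectrum A"
    unfolding spectrum_def eigenvalue_def by blast
  then show ?thesis using A by (auto simp: hermitian_mats_in_def)
qed

section \<open>The inequality for convex functions\<close>

lemma convex_positive_map:
  assumes \<Phi>: "unital_positive_linear_map n d \<Phi>"
    and A: "A \<in> hermitian_mats_in n \<Omega>" and f: "convex_on \<Omega> f"
  shows "\<exists>U \<in> unitary_mats d. \<exists>V \<in> unitary_mats d.
          loewner_le d (mat_fun f (\<Phi> A))
            ((1/2) \<cdot>\<^sub>m (conj_by U (\<Phi> (mat_fun f A)) + conj_by V (\<Phi> (mat_fun f A))))"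
    and "mono_on \<Omega> f \<or> antimono_on \<Omega> f \<Longrightarrow>
      \<exists>U \<in> unitary_mats d. loewner_le d (mat_fun f (\<Phi> A)) (conj_by U (\<Phi> (mat_fun f A)))"
proof -
  have "A \<in> hermitian_mats n" using A by (simp add: hermitian_mats_in_def)
  then obtain P a where P: "P \<in> unitary_mats n"
    and Aa: "A = conj_by P (mat_diag n (\<lambda>i. complex_of_real (a i)))"
    using hermitian_diagonalization by blast
  have Pc: "P \<in> carrier_mat n n" using P by (rule unitary_carrier)
  have a: "a i \<in> \<Omega>" if "i < n" for i
    using hermitian_mats_in_diagonal[OF A P Aa that] .
  define X where "X = \<Phi> (mat_fun f A)"
  have X: "X = \<Phi> (conj_by P (mat_diag n (\<lambda>i. complex_of_real (f (a i)))))"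
    unfolding X_def Aa mat_fun_conj_by[OF P] ..
  have Xh: "X \<in> hermitian_mats d" and Bh: "\<Phi> A \<in> hermitian_mats d"
    unfolding X Aa by (rule positive_map_conj_by_mat_diag(1)[OF \<Phi> Pc])+
  obtain Q b where Q: "Q \<in> unitary_mats d"
    and Bb: "\<Phi> A = conj_by Q (mat_diag d (\<lambda>i. complex_of_real (b i)))"
    using hermitian_diagonalization[OF Bh] by blast
  have Qc: "Q \<in> carrier_mat d d" "mat_adjoint Q \<in> carrier_mat d d"
    using Q by (auto intro: unitary_carrier unitary_adjoint)
  have Xc: "X \<in> carrier_mat d d" using Xh by (rule hermitian_carrier)
  \<comment> \<open>The matrix \<open>X\<close> in the eigenbasis of \<open>\<Phi> A\<close>, in
    which \<open>mat_fun f (\<Phi> A)\<close> is diagonal with entries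
    \<open>f (b i)\<close>.\<close>
  define X' where "X' = conj_by (mat_adjoint Q) X"
  have X'h: "X' \<in> hermitian_mats d" unfolding X'_def using conj_by_hermitian[OF Qc(2) Xh] .
  have X'c: "X' \<in> carrier_mat d d" using X'h by (rule hermitian_carrier)

  \<comment> \<open>Jensen at \<open>h = Q *\<^sub>v v\<close>: since \<open>Q\<close> preserves
    norms, the quotient becomes the mean of the \<open>b i\<close> weighted by the squared moduli of
    the coordinates of \<open>v\<close>.\<close>
  have avg: "(\<Sum>i<d. b i * (cmod (v $ i))\<^sup>2) / rform (1\<^sub>m d) v \<in> \<Omega>"
    "f ((\<Sum>i<d. b i * (cmod (v $ i))\<^sup>2) / rform (1\<^sub>m d) v) * rform (1\<^sub>m d) v \<le> rform X' v"
    if v: "v \<in> carrier_vec d" "v \<noteq> 0\<^sub>v d" for v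
  proof -
    define h where "h = Q *\<^sub>v v"
    have h: "h \<in> carrier_vec d" using Qc v by (simp add: h_def)
    have N: "rform (1\<^sub>m d) h = rform (1\<^sub>m d) v"
      unfolding h_def using rform_one_unitary[OF Q v(1)] .
    have "h \<noteq> 0\<^sub>v d"
      using rform_one_pos[OF v] N by (auto simp: rform_one)
    note J = positive_map_jensen[where a = a, OF \<Phi> P f a h this, folded X Aa, unfolded N]
    have tr: "rform (conj_by (mat_adjoint Q) M) v = rform M h" if "M \<in> carrier_mat d d" for M
      using rform_conj_by[OF Qc(2) that v(1)] by (simp add: h_def)
    have "(\<Sum>i<d. b i * (cmod (v $ i))\<^sup>2) = rform (\<Phi> A) h"
      using tr[OF hermitian_carrier[OF Bh]] conj_by_adjoint_cancel(2)[OF Q mat_diag_dim]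
        rform_mat_diag[OF v(1), of b] unfolding Bb by simp
    then show "(\<Sum>i<d. b i * (cmod (v $ i))\<^sup>2) / rform (1\<^sub>m d) v \<in> \<Omega>"
      "f ((\<Sum>i<d. b i * (cmod (v $ i))\<^sup>2) / rform (1\<^sub>m d) v) * rform (1\<^sub>m d) v \<le> rform X' v"
      unfolding X'_def tr[OF Xc] using J by simp_all
  qed
  \<comment> \<open>At a unit vector the weighted mean is \<open>b i\<close> itself.\<close>
  have b: "b i \<in> \<Omega>" if i: "i < d" for i
  proof -
    have *: "(\<Sum>j<d. c j * (cmod (unit_vec d i $ j))\<^sup>2) = c i" for c :: "nat \<Rightarrow> real"
    proof -
      have "(\<Sum>j<d. c j * (cmod (unit_vec d i $ j))\<^sup>2) = (\<Sum>j<d. if j = i then c j else 0)"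
        using i by (intro sum.cong) auto
      then show ?thesis using i by simp
    qed
    have "unit_vec d i \<noteq> (0\<^sub>v d :: complex vec)" using i by (rule unit_vec_nonzero)
    then have "(\<Sum>j<d. b j * (cmod (unit_vec d i $ j))\<^sup>2) / rform (1\<^sub>m d) (unit_vec d i) \<in> \<Omega>"
      by (intro avg(1)) auto
    then show ?thesis
      unfolding * using *[of "\<lambda>_. 1"] by (simp add: rform_one)
  qed

  \<comment> \<open>The alternative in \<open>side\<close> says that the support of \<open>v\<close>
    stays on the decreasing or on the increasing branch of \<open>f\<close>. The zero vector is
    treated apart because the mean divides by its norm.\<close>
  have bound: "m * rform (1\<^sub>m d) v \<le> rform X' v"
    if v: "v \<in> carrier_vec d" and m: "\<And>i. i < d \<Longrightarrow> v $ i \<noteq> 0 \<Longrightarrow> m \<le> f (b i)"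
      and side: "(\<forall>i<d. v $ i \<noteq> 0 \<longrightarrow> antimono_on (\<Omega> \<inter> {..b i}) f) \<or>
        (\<forall>i<d. v $ i \<noteq> 0 \<longrightarrow> mono_on (\<Omega> \<inter> {b i..}) f)"
    for v m
  proof (cases "v = 0\<^sub>v d")
    case True
    then show ?thesis using X'c by (simp add: rform_def)
  next
    case False
    define N where "N = rform (1\<^sub>m d) v"
    have N: "N > 0" unfolding N_def using rform_one_pos[OF v False] .
    define x where "x = (\<Sum>i<d. b i * (cmod (v $ i))\<^sup>2) / N"
    have x: "x \<in> \<Omega>" "f x * N \<le> rform X' v"
      using avg[OF v False] unfolding x_def N_def .
    define S where "S = {i. i < d \<and> v $ i \<noteq> 0}"
    have "finite S" by (simp add: S_def)
    moreover have "S \<noteq> {}"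
      using v False by (auto simp: S_def intro!: eq_vecI)
    ultimately have S: "finite (b ` S)" "b ` S \<noteq> {}" by auto
    have "m \<le> f x"
      using side
    proof
      \<comment> \<open>The mean \<open>x\<close> is at most the largest supported eigenvalue
        \<open>b p\<close>, and \<open>f\<close> decreases up to \<open>b p\<close>; hence
        \<open>m \<le> f (b p) \<le> f x\<close>.\<close>
      assume anti: "\<forall>i<d. v $ i \<noteq> 0 \<longrightarrow> antimono_on (\<Omega> \<inter> {..b i}) f"
      obtain p where p: "p \<in> S" "Max (b ` S) = b p" using Max_in[OF S] by auto
      have "(\<Sum>i<d. b i * (cmod (v $ i))\<^sup>2) \<le> (\<Sum>i<d. b p * (cmod (v $ i))\<^sup>2)"
      proof (rule sum_mono)
        fix i assume i: "i \<in> {..<d}"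
        show "b i * (cmod (v $ i))\<^sup>2 \<le> b p * (cmod (v $ i))\<^sup>2"
        proof (cases "v $ i = 0")
          case False
          then have "b i \<in> b ` S" using i by (auto simp: S_def)
          then show ?thesis using Max_ge[OF S(1)] unfolding p(2) by (intro mult_right_mono) auto
        qed simp
      qed
      also have "\<dots> = b p * N" by (simp add: N_def rform_one[OF v] sum_distrib_left)
      finally have "x \<le> b p" using N by (simp add: x_def divide_simps)
      then have "f (b p) \<le> f x"
        using anti p x b by (intro monotone_onD[of "\<Omega> \<inter> {..b p}" "(\<le>)" "(\<ge>)" f]) (auto simp: S_def)
      then show ?thesis using m[of p] p by (simp add: S_def)
    next
      \<comment> \<open>The mirror image, with the smallest supported eigenvalue.\<close>
      assume mono: "\<forall>i<d. v $ i \<noteq> 0 \<longrightarrow> mono_on (\<Omega> \<inter> {b i..}) f"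
      obtain p where p: "p \<in> S" "Min (b ` S) = b p" using Min_in[OF S] by auto
      have "b p * N = (\<Sum>i<d. b p * (cmod (v $ i))\<^sup>2)"
        by (simp add: N_def rform_one[OF v] sum_distrib_left)
      also have "\<dots> \<le> (\<Sum>i<d. b i * (cmod (v $ i))\<^sup>2)"
      proof (rule sum_mono)
        fix i assume i: "i \<in> {..<d}"
        show "b p * (cmod (v $ i))\<^sup>2 \<le> b i * (cmod (v $ i))\<^sup>2"
        proof (cases "v $ i = 0")
          case False
          then have "b i \<in> b ` S" using i by (auto simp: S_def)
          then show ?thesis using Min_le[OF S(1)] unfolding p(2) by (intro mult_right_mono) auto
        qed simp
      qed
      finally have "b p \<le> x" using N by (simp add: x_def divide_simps)
      then have "f (b p) \<le> f x"
        using mono p x b by (intro monotone_onD[of "\<Omega> \<inter> {b p..}" "(\<le>)" "(\<le>)" f]) (auto simp: S_def)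
      then show ?thesis using m[of p] p by (simp add: S_def)
    qed
    then have "m * N \<le> f x * N" using N by (intro mult_right_mono) auto
    then show ?thesis using x(2) unfolding N_def by linarith
  qed

  \<comment> \<open>Conjugation by \<open>Q\<close> leads back from the eigenbasis of
    \<open>\<Phi> A\<close>.\<close>
  have conj_Q: "loewner_le d (mat_fun f (\<Phi> A)) (conj_by (Q * U) Y)"
    if "loewner_le d (mat_diag d (\<lambda>i. complex_of_real (f (b i)))) (conj_by U Y)"
      "U \<in> unitary_mats d" "Y \<in> carrier_mat d d" for U Y
    using loewner_le_conj_by[OF that(1) Qc(1)] conj_by_conj_by[OF Qc(1) unitary_carrier[OF that(2)] that(3)]
    unfolding Bb mat_fun_conj_by[OF Q] by simp

  show "\<exists>U \<in> unitary_mats d. loewner_le d (mat_fun f (\<Phi> A)) (conj_by U (\<Phi> (mat_fun f A)))"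
    if "mono_on \<Omega> f \<or> antimono_on \<Omega> f"
  proof -
    \<comment> \<open>A monotone \<open>f\<close> has a single branch, so \<open>bound\<close>
      covers every vector and \<open>X'\<close> can be compared directly, without a
      pinching.\<close>
    have "(\<forall>p. antimono_on (\<Omega> \<inter> {..p}) f) \<or> (\<forall>p. mono_on (\<Omega> \<inter> {p..}) f)"
      using that by (auto intro: monotone_on_subset)
    then have "\<exists>U\<in>unitary_mats d.
        loewner_le d (mat_diag d (\<lambda>i. complex_of_real (f (b i)))) (conj_by U X')"
      by (intro loewner_le_conj_by_of_support_bound[OF X'h] bound) auto
    then obtain U where U: "U \<in> unitary_mats d"
      "loewner_le d (mat_diag d (\<lambda>i. complex_of_real (f (b i)))) (conj_by U X')" by blast
    have QU: "Q * U \<in> unitary_mats d" using unitary_mult[OF Q U(1)] .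
    have "loewner_le d (mat_fun f (\<Phi> A)) (conj_by (Q * U * mat_adjoint Q) X)"
      using conj_Q[OF U(2,1) X'c] conj_by_conj_by[OF unitary_carrier[OF QU] Qc(2) Xc]
      unfolding X'_def by simp
    then show ?thesis
      using unitary_mult[OF QU unitary_adjoint[OF Q]] unfolding X_def by blast
  qed

  \<comment> \<open>The block-diagonal part of \<open>X'\<close> with respect to \<open>S\<close> and its complement is the mean of
    \<open>X'\<close> and its conjugate by the reflection \<open>W\<close>; this is where the second unitary comes from.\<close>
  define S where "S = {i. antimono_on (\<Omega> \<inter> {..b i}) f}"
  define W where "W = mat_diag d (\<lambda>i. complex_of_real (if i \<in> S then 1 else - 1))"
  have Wc: "W \<in> carrier_mat d d" by (simp add: W_def)
  have Wadj: "mat_adjoint W = W"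
    using mat_diag_hermitian[of d "\<lambda>i. if i \<in> S then 1 else - 1"]
    unfolding W_def hermitian_mats_def by blast
  have W: "W \<in> unitary_mats d"
  proof (rule unitaryI[OF Wc])
    have "(\<lambda>i. complex_of_real (if i \<in> S then 1 else - 1) * complex_of_real (if i \<in> S then 1 else - 1))
        = (\<lambda>_. 1)"
      by auto
    then show "mat_adjoint W * W = 1\<^sub>m d" unfolding Wadj unfolding W_def mat_diag_diag by simp
  qed
  define Y where "Y = complex_of_real (1/2) \<cdot>\<^sub>m (X' + conj_by W X')"
  have WXh: "conj_by W X' \<in> hermitian_mats d" using conj_by_hermitian[OF Wc X'h] .
  have sum_h: "X' + conj_by W X' \<in> hermitian_mats d" using hermitian_add[OF X'h WXh] .
  have Yh: "Y \<in> hermitian_mats d" unfolding Y_def using hermitian_smult[OF sum_h] .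
  have "\<exists>U\<in>unitary_mats d.
      loewner_le d (mat_diag d (\<lambda>i. complex_of_real (f (b i)))) (conj_by U Y)"
  proof (rule loewner_le_conj_by_of_support_bound[OF Yh])
    fix m and v :: "complex vec"
    assume v: "v \<in> carrier_vec d" and m: "\<And>i. i < d \<Longrightarrow> v $ i \<noteq> 0 \<Longrightarrow> m \<le> f (b i)"
    \<comment> \<open>The components of \<open>v\<close> in the two blocks; \<open>W\<close> fixes
      \<open>s\<close> and negates \<open>t\<close>.\<close>
    define s where "s = vec d (\<lambda>i. if i \<in> S then v $ i else 0)"
    define t where "t = vec d (\<lambda>i. if i \<in> S then 0 else v $ i)"
    have st: "s \<in> carrier_vec d" "t \<in> carrier_vec d" by (simp_all add: s_def t_def)
    have v_eq: "v = s + t" using v by (intro eq_vecI) (auto simp: s_def t_def)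
    have Wv: "mat_adjoint W *\<^sub>v v = s - t"
    proof (rule eq_vecI)
      fix i assume "i < dim_vec (s - t)"
      then have i: "i < d" by (simp add: t_def)
      have "(W *\<^sub>v v) $ i = complex_of_real (if i \<in> S then 1 else - 1) * v $ i"
        unfolding W_def by (rule mat_diag_mult_vec_index[OF v i])
      then show "(mat_adjoint W *\<^sub>v v) $ i = (s - t) $ i"
        unfolding Wadj using i by (simp add: s_def t_def)
    qed (use Wc in \<open>simp add: Wadj t_def\<close>)
    have "rform (1\<^sub>m d) v = rform (1\<^sub>m d) s + rform (1\<^sub>m d) t"
      unfolding rform_one[OF v] rform_one[OF st(1)] rform_one[OF st(2)] sum.distrib[symmetric]
      by (intro sum.cong) (auto simp: s_def t_def)
    then have "m * rform (1\<^sub>m d) v = m * rform (1\<^sub>m d) s + m * rform (1\<^sub>m d) t"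
      by (simp add: distrib_left)
    also have "m * rform (1\<^sub>m d) s \<le> rform X' s"
      by (rule bound[OF st(1)]) (use m in \<open>auto simp: s_def S_def split: if_splits\<close>)
    also have "m * rform (1\<^sub>m d) t \<le> rform X' t"
    proof (rule bound[OF st(2)])
      \<comment> \<open>Outside \<open>S\<close> the dichotomy for convex functions leaves only the
        increasing side.\<close>
      have "mono_on (\<Omega> \<inter> {b i..}) f" if "i < d" "t $ i \<noteq> 0" for i
        using convex_on_antimono_or_mono[OF f b[OF that(1)]] that
        by (auto simp: t_def S_def split: if_splits)
      then show "(\<forall>i<d. t $ i \<noteq> 0 \<longrightarrow> antimono_on (\<Omega> \<inter> {..b i}) f) \<or>
        (\<forall>i<d. t $ i \<noteq> 0 \<longrightarrow> mono_on (\<Omega> \<inter> {b i..}) f)" by blast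
    qed (use m in \<open>auto simp: t_def split: if_splits\<close>)
    \<comment> \<open>The form of \<open>Y\<close> at \<open>v\<close> is the mean of the forms of
      \<open>X'\<close> at \<open>s + t\<close> and \<open>s - t\<close>, so the parallelogram law
      removes the interaction of the blocks.\<close>
    also have "rform X' s + rform X' t = rform Y v"
      using rform_parallelogram[OF X'c st] rform_conj_by[OF Wc X'c v]
        rform_add[OF X'c hermitian_carrier[OF WXh] v]
      unfolding Y_def rform_smult[OF hermitian_carrier[OF sum_h] v] Wv v_eq[symmetric] by simp
    finally show "m * rform (1\<^sub>m d) v \<le> rform Y v" by simp
  qed
  then obtain U where U: "U \<in> unitary_mats d"
    "loewner_le d (mat_diag d (\<lambda>i. complex_of_real (f (b i)))) (conj_by U Y)" by blast
  have QU: "Q * U \<in> unitary_mats d" using unitary_mult[OF Q U(1)] .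
  have QUc: "Q * U \<in> carrier_mat d d" using QU by (rule unitary_carrier)
  have QUW: "Q * U * W \<in> unitary_mats d" using unitary_mult[OF QU W] .
  \<comment> \<open>The two halves of the pinching become two conjugates of \<open>X\<close>, by
    unitaries that differ only in the factor \<open>W\<close>.\<close>
  have "conj_by (Q * U) Y = (1/2) \<cdot>\<^sub>m (conj_by (Q * U) X' + conj_by (Q * U * W) X')"
    unfolding Y_def conj_by_smult[OF QUc hermitian_carrier[OF sum_h]]
      conj_by_add[OF QUc X'c hermitian_carrier[OF WXh]] conj_by_conj_by[OF QUc Wc X'c]
    by simp
  also have "conj_by (Q * U) X' = conj_by (Q * U * mat_adjoint Q) X"
    unfolding X'_def conj_by_conj_by[OF QUc Qc(2) Xc] ..
  also have "conj_by (Q * U * W) X' = conj_by (Q * U * W * mat_adjoint Q) X"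
    unfolding X'_def conj_by_conj_by[OF unitary_carrier[OF QUW] Qc(2) Xc] ..
  finally have "loewner_le d (mat_fun f (\<Phi> A))
      ((1/2) \<cdot>\<^sub>m (conj_by (Q * U * mat_adjoint Q) X + conj_by (Q * U * W * mat_adjoint Q) X))"
    using conj_Q[OF U(2,1) hermitian_carrier[OF Yh]] by simp
  then show "\<exists>U \<in> unitary_mats d. \<exists>V \<in> unitary_mats d.
          loewner_le d (mat_fun f (\<Phi> A))
            ((1/2) \<cdot>\<^sub>m (conj_by U (\<Phi> (mat_fun f A)) + conj_by V (\<Phi> (mat_fun f A))))"
    using unitary_mult[OF QU unitary_adjoint[OF Q]] unitary_mult[OF QUW unitary_adjoint[OF Q]]
    unfolding X_def by blast
qed

section \<open>Concave functions by negation\<close>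

lemma mat_fun_uminus:
  assumes "A \<in> hermitian_mats n"
  shows "mat_fun (\<lambda>x. - f x) A = complex_of_real (-1) \<cdot>\<^sub>m mat_fun f A"
proof -
  obtain P a where P: "P \<in> unitary_mats n"
    and A: "A = conj_by P (mat_diag n (\<lambda>i. complex_of_real (a i)))"
    using hermitian_diagonalization[OF assms] by blast
  have "mat_diag n (\<lambda>i. complex_of_real (- f (a i)))
      = complex_of_real (-1) \<cdot>\<^sub>m mat_diag n (\<lambda>i. complex_of_real (f (a i)))"
    by (intro eq_matI) (auto simp: mat_diag_def)
  then show ?thesis
    unfolding A mat_fun_conj_by[OF P] using conj_by_smult[OF unitary_carrier[OF P] mat_diag_dim] by simp
qed

text \<open>The convex case is applied to \<open>- f\<close>. The sign passes through the functional
  calculus, \<open>\<Phi>\<close>, the conjugations and the mean, and cancelling it reverses the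
  order.\<close>

lemma concave_positive_map:
  assumes \<Phi>: "unital_positive_linear_map n d \<Phi>"
    and A: "A \<in> hermitian_mats_in n \<Omega>" and f: "concave_on \<Omega> f"
  shows "\<exists>U \<in> unitary_mats d. \<exists>V \<in> unitary_mats d.
          loewner_le d
            ((1/2) \<cdot>\<^sub>m (conj_by U (\<Phi> (mat_fun f A)) + conj_by V (\<Phi> (mat_fun f A))))
            (mat_fun f (\<Phi> A))"
    and "mono_on \<Omega> f \<or> antimono_on \<Omega> f \<Longrightarrow>
      \<exists>U \<in> unitary_mats d. loewner_le d (conj_by U (\<Phi> (mat_fun f A))) (mat_fun f (\<Phi> A))"
proof -
  have Ah: "A \<in> hermitian_mats n" using A by (simp add: hermitian_mats_in_def)
  then obtain P a where P: "P \<in> unitary_mats n"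
    and Aa: "A = conj_by P (mat_diag n (\<lambda>i. complex_of_real (a i)))"
    using hermitian_diagonalization by blast
  have Pc: "P \<in> carrier_mat n n" using P by (rule unitary_carrier)
  have Bh: "\<Phi> A \<in> hermitian_mats d"
    unfolding Aa by (rule positive_map_conj_by_mat_diag(1)[OF \<Phi> Pc])
  have fA: "mat_fun f A \<in> carrier_mat n n"
    unfolding Aa mat_fun_conj_by[OF P] using Pc by simp
  have Xc: "\<Phi> (mat_fun f A) \<in> carrier_mat d d"
    using \<Phi> fA unfolding unital_positive_linear_map_def linear_mat_map_def by blast
  have \<Phi>neg: "\<Phi> (mat_fun (\<lambda>x. - f x) A) = complex_of_real (-1) \<cdot>\<^sub>m \<Phi> (mat_fun f A)"
    unfolding mat_fun_uminus[OF Ah] using unital_positive_linear_mapD(4)[OF \<Phi> fA] .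
  have neg: "convex_on \<Omega> (\<lambda>x. - f x)" using f by (simp add: concave_on_def)
  have conj_neg: "conj_by U (complex_of_real (-1) \<cdot>\<^sub>m \<Phi> (mat_fun f A))
      = complex_of_real (-1) \<cdot>\<^sub>m conj_by U (\<Phi> (mat_fun f A))" if "U \<in> unitary_mats d" for U
    using conj_by_smult[OF unitary_carrier[OF that] Xc] .
  note convex = convex_positive_map[OF \<Phi> A neg, unfolded \<Phi>neg mat_fun_uminus[OF Bh]]
  obtain U V where UV: "U \<in> unitary_mats d" "V \<in> unitary_mats d"
    and le: "loewner_le d (complex_of_real (-1) \<cdot>\<^sub>m mat_fun f (\<Phi> A))
      ((1/2) \<cdot>\<^sub>m (conj_by U (complex_of_real (-1) \<cdot>\<^sub>m \<Phi> (mat_fun f A))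
        + conj_by V (complex_of_real (-1) \<cdot>\<^sub>m \<Phi> (mat_fun f A))))"
    using convex(1) by blast
  have c: "conj_by U (\<Phi> (mat_fun f A)) \<in> carrier_mat d d" "conj_by V (\<Phi> (mat_fun f A)) \<in> carrier_mat d d"
    using UV Xc by (auto intro: conj_by_carrier unitary_carrier)
  have "(1/2) \<cdot>\<^sub>m (complex_of_real (-1) \<cdot>\<^sub>m M + complex_of_real (-1) \<cdot>\<^sub>m N)
      = complex_of_real (-1) \<cdot>\<^sub>m ((1/2) \<cdot>\<^sub>m (M + N))"
    if "M \<in> carrier_mat d d" "N \<in> carrier_mat d d" for M N
    using that by (intro eq_matI) (auto simp: algebra_simps)
  then have "loewner_le d (complex_of_real (-1) \<cdot>\<^sub>m mat_fun f (\<Phi> A))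
      (complex_of_real (-1) \<cdot>\<^sub>m
        ((1/2) \<cdot>\<^sub>m (conj_by U (\<Phi> (mat_fun f A)) + conj_by V (\<Phi> (mat_fun f A)))))"
    using le c unfolding conj_neg[OF UV(1)] conj_neg[OF UV(2)] by simp
  from loewner_le_uminus[OF this] show "\<exists>U \<in> unitary_mats d. \<exists>V \<in> unitary_mats d.
          loewner_le d
            ((1/2) \<cdot>\<^sub>m (conj_by U (\<Phi> (mat_fun f A)) + conj_by V (\<Phi> (mat_fun f A))))
            (mat_fun f (\<Phi> A))"
    using UV by blast
  assume "mono_on \<Omega> f \<or> antimono_on \<Omega> f"
  then have "mono_on \<Omega> (\<lambda>x. - f x) \<or> antimono_on \<Omega> (\<lambda>x. - f x)"
    by (auto simp: monotone_on_def)
  then obtain U where U: "U \<in> unitary_mats d"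
    and le: "loewner_le d (complex_of_real (-1) \<cdot>\<^sub>m mat_fun f (\<Phi> A))
      (conj_by U (complex_of_real (-1) \<cdot>\<^sub>m \<Phi> (mat_fun f A)))"
    using convex(2) by blast
  then show "\<exists>U \<in> unitary_mats d. loewner_le d (conj_by U (\<Phi> (mat_fun f A))) (mat_fun f (\<Phi> A))"
    using loewner_le_uminus[OF le[unfolded conj_neg[OF U]]] by blast
qed

theorem theorem2p1:
  fixes n d :: nat
    and \<Phi> :: "complex mat \<Rightarrow> complex mat"
    and \<Omega> :: "real set"
    and f :: "real \<Rightarrow> real"
    and A :: "complex mat"
  assumes "unital_positive_linear_map n d \<Phi>"
    and "is_interval \<Omega>"
    and "A \<in> hermitian_mats_in n \<Omega>"
  shows
    "(convex_on \<Omega> f \<longrightarrow>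
        (\<exists>U \<in> unitary_mats d. \<exists>V \<in> unitary_mats d.
          loewner_le d (mat_fun f (\<Phi> A))
            ((1/2) \<cdot>\<^sub>m (conj_by U (\<Phi> (mat_fun f A)) + conj_by V (\<Phi> (mat_fun f A))))) \<and>
        (mono_on \<Omega> f \<or> antimono_on \<Omega> f \<longrightarrow>
          (\<exists>U \<in> unitary_mats d.
            loewner_le d (mat_fun f (\<Phi> A)) (conj_by U (\<Phi> (mat_fun f A)))))) \<and>
     (concave_on \<Omega> f \<longrightarrow>
        (\<exists>U \<in> unitary_mats d. \<exists>V \<in> unitary_mats d.
          loewner_le d
            ((1/2) \<cdot>\<^sub>m (conj_by U (\<Phi> (mat_fun f A)) + conj_by V (\<Phi> (mat_fun f A))))
            (mat_fun f (\<Phi> A))) \<and>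
        (mono_on \<Omega> f \<or> antimono_on \<Omega> f \<longrightarrow>
          (\<exists>U \<in> unitary_mats d.
            loewner_le d (conj_by U (\<Phi> (mat_fun f A))) (mat_fun f (\<Phi> A)))))"
  using convex_positive_map[OF assms(1,3)] concave_positive_map[OF assms(1,3)]
  by (intro conjI impI) blast+

end
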